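(* Given a link type $[L]$, let $$\mathcal{G}([L])=\{G(D,\sigma)\mid D\text{ is a diagram of a link of type }[L]\text{ and }\sigma\text{ is either of the two shadings of }D\},$$ $$\mathcal{G}_s([L])=\{G(D,\sigma_s)\mid D\text{ is a diagram of a link of type }[L]\},$$ $$\mathcal{G}_u([L])=\{G(D,\sigma_u)\mid D\text{ is a diagram of a link of type }[L]\}.$$ Then $\mathcal{G}([L])=\mathcal{G}_s([L])=\mathcal{G}_u([L])$.
   Context: A (classical, unoriented) link is a finite union of pairwise disjoint, piecewise smooth simple closed curves in $\mathbb{R}^3$; a link type $[L]$ is a class of links under piecewise smooth, orientation-preserving autohomeomorphisms of $\mathbb{R}^3$. A link diagram $D$ is a projection of a link to a plane whose only singularities are finitely many transverse double points (crossings), together with over/under information at each crossing (crossing-free closed curves are allowed). The universe of $D$ is the image of the projection; the complementary regions are the connected components of its complement in the plane. A checkerboard shading $\sigma$ of $D$ labels each complementary region shaded or unshaded so that every edge of the universe has a shaded region on one side and an unshaded region on the other; there are exactly two. $\sigma_s$ denotes the shading in which the unbounded region is shaded, and $\sigma_u$ the shading in which it is unshaded. Given $\sigma$, the Goeritz index of a crossing $c$ is $\eta(c)=1$ if an observer standing in an unshaded region and facing the crossing sees the overpassing arc on the right, and $\eta(c)=-1$ if such an observer sees it on the left. Let $R_1,\dots,R_n$ be the unshaded regions according to $\sigma$, and let $C_{ij}$ be the set of crossings incident on $R_i$ and $R_j$. The Goeritz matrix $G(D,\sigma)$ is the $n\times n$ integer matrix with $G(D,\sigma)_{ij}=-\sum_{c\in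 C_{ij}}\eta(c)$ for $i\ne j$ and $G(D,\sigma)_{ii}=-\sum_{k\neq i}G(D,\sigma)_{ik}$. Rows and columns are regarded as unordered, so two such matrices are considered equal if they agree after a bijection of index sets (a simultaneous permutation of rows and columns). *)

theory Defs
  imports "HOL-Analysis.Analysis" "Jordan_Normal_Form.Matrix"
begin

section \<open>Smooth and piecewise smooth maps\<close>

text \<open>Intended for open \<open>S\<close>: on an open set this is \<open>C\<^sup>k\<close>, expressed through iterated directional
  derivatives.\<close>

primrec Ck_on :: "nat \<Rightarrow> 'a::euclidean_space set \<Rightarrow> ('a \<Rightarrow> 'b::euclidean_space) \<Rightarrow> bool" where
  "Ck_on 0 S f \<longleftrightarrow> continuous_on S f"
| "Ck_on (Suc k) S f \<longleftrightarrow>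
     (\<forall>x\<in>S. f differentiable (at x)) \<and> (\<forall>v. Ck_on k S (\<lambda>x. frechet_derivative f (at x) v))"

definition smooth_on :: "'a::euclidean_space set \<Rightarrow> ('a \<Rightarrow> 'b::euclidean_space) \<Rightarrow> bool" where
  "smooth_on S f \<longleftrightarrow> (\<forall>k. Ck_on k S f)"

text \<open>Maps between Euclidean spaces are piecewise smooth if they are continuous and locally a
  selection from finitely many smooth maps (the usual notion of a \<open>PC\<^sup>\<infinity>\<close> function); the pieces are
  the sets where \<open>f\<close> agrees with one of the \<open>g\<close>. This class is closed under composition.\<close>

definition piecewise_smooth :: "('a::euclidean_space \<Rightarrow> 'b::euclidean_space) \<Rightarrow> bool" where
  "piecewise_smooth f \<longleftrightarrow> continuous_on UNIV f \<and>
     (\<forall>x. \<exists>U F. open U \<and> x \<in> U \<and> finite F \<and> (\<forall>g\<in>F. smooth_on U g) \<and> (\<forall>y\<in>U. \<exists>g\<in>F. f y = g y))"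

definition piecewise_smooth_autohomeo :: "('a::euclidean_space \<Rightarrow> 'a) \<Rightarrow> bool" where
  "piecewise_smooth_autohomeo h \<longleftrightarrow>
     (\<exists>k. homeomorphism UNIV UNIV h k \<and> piecewise_smooth h \<and> piecewise_smooth k)"

text \<open>Only used for piecewise smooth autohomeomorphisms. These are locally bi-Lipschitz, so they are
  differentiable on a dense set of points, with invertible derivatives of one and the same sign.\<close>

definition orientation_preserving :: "(real^3 \<Rightarrow> real^3) \<Rightarrow> bool" where
  "orientation_preserving h \<longleftrightarrow>
     (\<forall>x. h differentiable (at x) \<longrightarrow> Determinants.det (matrix (frechet_derivative h (at x))) > 0)"

text \<open>Piecewise smooth curves are regular: on each closed subinterval of some finite partition the
  curve extends to a smooth curve whose velocity does not vanish there.\<close>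

definition piecewise_smooth_curve :: "(real \<Rightarrow> 'a::euclidean_space) \<Rightarrow> bool" where
  "piecewise_smooth_curve c \<longleftrightarrow> path c \<and>
     (\<exists>T. finite T \<and> {0, 1} \<subseteq> T \<and> T \<subseteq> {0..1} \<and>
       (\<forall>a\<in>T. \<forall>b\<in>T. a < b \<and> {a<..<b} \<inter> T = {} \<longrightarrow>
         (\<exists>V g. open V \<and> {a..b} \<subseteq> V \<and> smooth_on V g \<and>
            (\<forall>t\<in>{a..b}. c t = g t \<and> vector_derivative g (at t) \<noteq> 0))))"

section \<open>Links and link types\<close>

definition link_parametrization :: "(real \<Rightarrow> real^3) set \<Rightarrow> (real^3) set \<Rightarrow> bool" where
  "link_parametrization \<Gamma> L \<longleftrightarrow>
     finite \<Gamma> \<and> \<Gamma> \<noteq> {} \<and>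
     (\<forall>\<gamma>\<in>\<Gamma>. simple_path \<gamma> \<and> pathfinish \<gamma> = pathstart \<gamma> \<and> piecewise_smooth_curve \<gamma>) \<and>
     pairwise (\<lambda>\<gamma> \<delta>. path_image \<gamma> \<inter> path_image \<delta> = {}) \<Gamma> \<and>
     L = (\<Union>\<gamma>\<in>\<Gamma>. path_image \<gamma>)"

definition link :: "(real^3) set \<Rightarrow> bool" where
  "link L \<longleftrightarrow> (\<exists>\<Gamma>. link_parametrization \<Gamma> L)"

definition link_type :: "(real^3) set \<Rightarrow> (real^3) set set" where
  "link_type L =
     {L'. link L' \<and> (\<exists>h. piecewise_smooth_autohomeo h \<and> orientation_preserving h \<and> h ` L = L')}"

section \<open>Link diagrams\<close>

text \<open>The projection goes along the third coordinate axis and is viewed from its positive end,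
  so that the plane of projection, identified with the complex numbers, has its usual
  orientation.\<close>

definition proj :: "real^3 \<Rightarrow> complex" where
  "proj p = Complex (p $ 1) (p $ 2)"

definition height :: "real^3 \<Rightarrow> real" where
  "height p = p $ 3"

text \<open>Nonzero velocities at \<open>p\<close> of smooth curves running in \<open>L\<close>. For a link \<open>L\<close> they exist only at
  points where \<open>L\<close> is smooth, and form the tangent line without the origin.\<close>

definition tangent_vector :: "(real^3) set \<Rightarrow> real^3 \<Rightarrow> real^3 \<Rightarrow> bool" where
  "tangent_vector L p v \<longleftrightarrow> v \<noteq> 0 \<and>
     (\<exists>g e. e > 0 \<and> smooth_on {-e<..<e} g \<and> g ` {-e<..<e} \<subseteq> L \<and>
        g 0 = p \<and> (g has_vector_derivative v) (at 0))"

text \<open>The condition on \<open>a\<close> and \<open>b\<close> below is linear independence over the reals.\<close>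

definition regular_projection :: "(real^3) set \<Rightarrow> bool" where
  "regular_projection L \<longleftrightarrow>
     (\<exists>\<Gamma>. link_parametrization \<Gamma> L \<and> (\<forall>\<gamma>\<in>\<Gamma>. piecewise_smooth_curve (proj \<circ> \<gamma>))) \<and>
     (\<forall>c. finite {p\<in>L. proj p = c} \<and> card {p\<in>L. proj p = c} \<le> 2) \<and>
     finite {c. card {p\<in>L. proj p = c} = 2} \<and>
     (\<forall>p\<in>L. \<forall>q\<in>L. p \<noteq> q \<and> proj p = proj q \<longrightarrow>
        (\<exists>v w. tangent_vector L p v \<and> tangent_vector L q w \<and> Im (cnj (proj v) * proj w) \<noteq> 0))"

text \<open>The over/under information at a crossing is recorded by the nonzero vectors tangent to the
  overpassing and to the underpassing arc.\<close>

record link_diagram =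
  universe :: "complex set"
  crossings :: "complex set"
  over_dirs :: "complex \<Rightarrow> complex set"
  under_dirs :: "complex \<Rightarrow> complex set"

definition projected_diagram :: "(real^3) set \<Rightarrow> link_diagram" where
  "projected_diagram L =
     \<lparr> universe = proj ` L,
       crossings = {c. \<exists>p\<in>L. \<exists>q\<in>L. p \<noteq> q \<and> proj p = c \<and> proj q = c},
       over_dirs = (\<lambda>c. {proj v | v p q. p \<in> L \<and> q \<in> L \<and> proj p = c \<and> proj q = c \<and>
                                          height p > height q \<and> tangent_vector L p v}),
       under_dirs = (\<lambda>c. {proj v | v p q. p \<in> L \<and> q \<in> L \<and> proj p = c \<and> proj q = c \<and>
                                           height p < height q \<and> tangent_vector L p v}) \<rparr>"

text \<open>The rotation \<open>A\<close> allows for projections to arbitrary planes through the origin.\<close>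

definition is_diagram :: "link_diagram \<Rightarrow> (real^3) set \<Rightarrow> bool" where
  "is_diagram D L \<longleftrightarrow> link L \<and>
     (\<exists>A. orthogonal_transformation A \<and> Determinants.det (matrix A) = 1 \<and>
        regular_projection (A ` L) \<and> D = projected_diagram (A ` L))"

definition regions :: "link_diagram \<Rightarrow> complex set set" where
  "regions D = components (- universe D)"

definition edges :: "link_diagram \<Rightarrow> complex set set" where
  "edges D = components (universe D - crossings D)"

section \<open>Checkerboard shadings and Goeritz matrices\<close>

text \<open>A shading is given by the set of its shaded regions.\<close>

definition checkerboard_shading :: "link_diagram \<Rightarrow> complex set set \<Rightarrow> bool" where
  "checkerboard_shading D \<sigma> \<longleftrightarrow> \<sigma> \<subseteq> regions D \<and>
     (\<forall>e\<in>edges D. \<exists>R\<in>\<sigma>. \<exists>R'\<in>regions D - \<sigma>. e \<subseteq> frontier R \<and> e \<subseteq> frontier R')"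

definition unshaded :: "link_diagram \<Rightarrow> complex set set \<Rightarrow> complex set set" where
  "unshaded D \<sigma> = regions D - \<sigma>"

definition unbounded_shaded :: "complex set set \<Rightarrow> bool" where
  "unbounded_shaded \<sigma> \<longleftrightarrow> (\<exists>R\<in>\<sigma>. \<not> bounded R)"

definition unbounded_unshaded :: "link_diagram \<Rightarrow> complex set set \<Rightarrow> bool" where
  "unbounded_unshaded D \<sigma> \<longleftrightarrow> (\<exists>R\<in>unshaded D \<sigma>. \<not> bounded R)"

text \<open>The observer stands at \<open>c + t (a + b)\<close>, in the corner at \<open>c\<close> spanned by the half-branch in
  direction \<open>a\<close> of the overpassing arc and the half-branch in direction \<open>b\<close> of the underpassing arc,
  and looks in direction \<open>- (a + b)\<close>. The overpassing half-branch is to the right if and only if the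
  turn from \<open>b\<close> to \<open>a\<close> is counterclockwise. As \<open>a\<close> and \<open>b\<close> may be replaced by their negatives,
  all four corners are considered.\<close>

definition sees_over_on_right :: "link_diagram \<Rightarrow> complex set set \<Rightarrow> complex \<Rightarrow> bool" where
  "sees_over_on_right D \<sigma> c \<longleftrightarrow>
     (\<exists>R\<in>unshaded D \<sigma>. \<exists>a\<in>over_dirs D c. \<exists>b\<in>under_dirs D c.
        (\<forall>\<^sub>F t in at_right 0. c + of_real t * (a + b) \<in> R) \<and> Im (cnj b * a) > 0)"

definition goeritz_index :: "link_diagram \<Rightarrow> complex set set \<Rightarrow> complex \<Rightarrow> int" where
  "goeritz_index D \<sigma> c = (if sees_over_on_right D \<sigma> c then 1 else -1)"

definition common_crossings :: "link_diagram \<Rightarrow> complex set \<Rightarrow> complex set \<Rightarrow> complex set" where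
  "common_crossings D R S = {c\<in>crossings D. c \<in> closure R \<and> c \<in> closure S}"

definition goeritz_offdiag ::
    "link_diagram \<Rightarrow> complex set set \<Rightarrow> complex set \<Rightarrow> complex set \<Rightarrow> int" where
  "goeritz_offdiag D \<sigma> R S = - (\<Sum>c\<in>common_crossings D R S. goeritz_index D \<sigma> c)"

definition goeritz_entry ::
    "link_diagram \<Rightarrow> complex set set \<Rightarrow> complex set \<Rightarrow> complex set \<Rightarrow> int" where
  "goeritz_entry D \<sigma> R S =
     (if R = S then - (\<Sum>T\<in>unshaded D \<sigma> - {R}. goeritz_offdiag D \<sigma> R T)
      else goeritz_offdiag D \<sigma> R S)"

text \<open>A matrix with unordered rows and columns is the set of all matrices obtained from it by ordering
  its index set, that is, an equivalence class under simultaneous permutations of rows and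
  columns. Here the list \<open>Rs\<close> enumerates the unshaded regions.\<close>

definition goeritz_matrix :: "link_diagram \<Rightarrow> complex set set \<Rightarrow> int mat set" where
  "goeritz_matrix D \<sigma> =
     {Matrix.mat (length Rs) (length Rs) (\<lambda>(i, j). goeritz_entry D \<sigma> (Rs ! i) (Rs ! j)) | Rs.
        distinct Rs \<and> set Rs = unshaded D \<sigma>}"

definition goeritz_set :: "(real^3) set set \<Rightarrow> int mat set set" where
  "goeritz_set \<L> = {goeritz_matrix D \<sigma> | D \<sigma>.
     (\<exists>L\<in>\<L>. is_diagram D L) \<and> checkerboard_shading D \<sigma>}"

definition goeritz_set_s :: "(real^3) set set \<Rightarrow> int mat set set" where
  "goeritz_set_s \<L> = {goeritz_matrix D \<sigma> | D \<sigma>.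
     (\<exists>L\<in>\<L>. is_diagram D L) \<and> checkerboard_shading D \<sigma> \<and> unbounded_shaded \<sigma>}"

definition goeritz_set_u :: "(real^3) set set \<Rightarrow> int mat set set" where
  "goeritz_set_u \<L> = {goeritz_matrix D \<sigma> | D \<sigma>.
     (\<exists>L\<in>\<L>. is_diagram D L) \<and> checkerboard_shading D \<sigma> \<and> unbounded_unshaded D \<sigma>}"

end

theory Submission
  imports Defs
begin

text \<open>Let \<open>P\<close> be a point of a region \<open>R\<close> of a diagram. The inversion \<open>z \<mapsto> P + 1 / (z - P)\<close> turns the
  diagram into one in which \<open>R\<close> has become the unbounded region. As the inversion is conformal, all
  incidences and Goeritz indices are preserved, so the Goeritz matrix is the same. Choosing \<open>R\<close> shaded
  or unshaded gives both equalities.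

  The lifted map \<open>(z, t) \<mapsto> (P + 1 / (z - P), t)\<close> is not defined on the axis over \<open>P\<close>, but on a compact
  link it agrees with a diffeomorphism of space: in the coordinates \<open>s = ln \<bar>z - P\<bar>\<close>,
  \<open>\<theta> = arg (z - P)\<close> and \<open>t\<close> it sends \<open>(s, \<theta>, t)\<close> to \<open>(- s, - \<theta>, t)\<close>, which is the half turn
  \<open>(s, - \<theta>, - t)\<close> about a horizontal line followed by the half turn \<open>(s, t) \<mapsto> (- s, - t)\<close> of the
  meridian half-planes, and the latter can be cut off smoothly outside a compact set.

  Goeritz indices are defined by straight rays at the crossings, which the inversion bends. At a
  crossing the universe is tangent to the two given lines only, so that a ray between them and a
  curve tangent to it eventually run in the same region.\<close>

section \<open>Calculus of smooth maps\<close>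

text \<open>The inversion lives on the sphere of projection, but link types are defined by maps of
  space. In the coordinates \<open>s\<close>, \<open>t\<close> of a meridian half-plane the required
  map is a reflection, which cannot be damped to the identity; the half turn, reversing the angle
  and the height, exchanges it for a rotation, which can. Orientation is then read off at one point
  of the axis, where only the half turn acts. Heights are kept, so over and under strands stay what
  they are.

  Links are only piecewise smooth, and a tangent vector at a crossing just comes from some smooth
  curve inside the link. That nothing else of the universe enters the corner along the observer's
  ray is shown with contingent cones: near a point a link has two arms, and a full tangent line uses
  up both of them.

  Many transfer statements are proved in one direction only; the other direction is the same
  statement for the inverted link, because the inversion is an involution. This includes the Goeritz
  index, which is defined by the existence of an observer.\<close>

lemma Ck_on_cong:
  assumes "open S" "\<And>x. x \<in> S \<Longrightarrow> f x = g x" "Ck_on k S f"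
  shows "Ck_on k S g"
  using assms(2,3)
proof (induction k arbitrary: f g)
  case 0
  then show ?case by (simp cong: continuous_on_cong)
next
  case (Suc k)
  have der: "(g has_derivative D) (at x)" if "x \<in> S" "(f has_derivative D) (at x)" for x D
    using that has_derivative_transform_within_open[OF that(2) \<open>open S\<close> that(1)] Suc.prems(1) by blast
  have diff: "(g has_derivative frechet_derivative f (at x)) (at x)" if "x \<in> S" for x
    using der[OF that] Suc.prems(2) that by (simp add: frechet_derivative_works)
  have eq: "frechet_derivative f (at x) = frechet_derivative g (at x)" if "x \<in> S" for x
    using diff[OF that] frechet_derivative_at by blast
  have "Ck_on k S (\<lambda>x. frechet_derivative g (at x) v)" for v
    by (rule Suc.IH[of "\<lambda>x. frechet_derivative f (at x) v"]) (use eq Suc.prems(2) in auto)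
  moreover have "g differentiable (at x)" if "x \<in> S" for x
    using diff[OF that] differentiable_def by blast
  ultimately show ?case by simp
qed

text \<open>Lets inductions run on an explicit formula \<open>D\<close> for the derivative; the
  choice-based \<open>frechet_derivative\<close> agrees with it on the open set.\<close>

lemma Ck_on_SucI:
  assumes "open S" "\<And>x. x \<in> S \<Longrightarrow> (f has_derivative D x) (at x)"
    and "\<And>v. Ck_on k S (\<lambda>x. D x v)"
  shows "Ck_on (Suc k) S f"
proof -
  have "frechet_derivative f (at x) = D x" if "x \<in> S" for x
    using assms(2)[OF that] frechet_derivative_at by metis
  then have "Ck_on k S (\<lambda>x. frechet_derivative f (at x) v)" for v
    using Ck_on_cong[OF assms(1) _ assms(3)[of v]] by auto
  with assms(2) show ?thesis by (auto simp: differentiable_def)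
qed

lemma Ck_on_has_derivative:
  assumes "Ck_on (Suc k) S f" "x \<in> S"
  shows "(f has_derivative frechet_derivative f (at x)) (at x)"
  using assms by (simp add: frechet_derivative_works)

lemma Ck_on_Suc_imp: "Ck_on (Suc k) S f \<Longrightarrow> Ck_on k S f"
proof (induction k arbitrary: f)
  case 0
  then have "f differentiable_on S"
    unfolding differentiable_on_def by (simp add: differentiable_at_withinI)
  then show ?case by (simp add: differentiable_imp_continuous_on)
next
  case (Suc k)
  then show ?case by (metis Ck_on.simps(2))
qed

lemma Ck_on_subset: "Ck_on k S f \<Longrightarrow> T \<subseteq> S \<Longrightarrow> Ck_on k T f"
  by (induction k arbitrary: f) (auto intro: continuous_on_subset)

lemma Ck_on_Un:
  assumes "open S" "open T" "Ck_on k S f" "Ck_on k T f"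
  shows "Ck_on k (S \<union> T) f"
  using assms(3,4) by (induction k arbitrary: f) (auto simp: assms(1,2) continuous_on_open_Un)

lemma Ck_on_const: "Ck_on k S (\<lambda>x. c)"
  by (induction k arbitrary: c) (auto simp: frechet_derivative_const)

lemma Ck_on_linear_comp:
  assumes "open S" "bounded_linear h" "Ck_on k S f"
  shows "Ck_on k S (\<lambda>x. h (f x))"
  using assms(3)
proof (induction k arbitrary: f)
  case 0
  then show ?case by (simp add: bounded_linear.continuous_on[OF assms(2)])
next
  case (Suc k)
  show ?case
    by (rule Ck_on_SucI[OF assms(1) bounded_linear.has_derivative[OF assms(2)
            Ck_on_has_derivative[OF Suc.prems]]])
      (use Suc in auto)
qed

lemma Ck_on_add:
  assumes "open S" "Ck_on k S f" "Ck_on k S g"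
  shows "Ck_on k S (\<lambda>x. f x + g x)"
  using assms(2,3)
proof (induction k arbitrary: f g)
  case 0
  then show ?case by (auto intro: continuous_intros)
next
  case (Suc k)
  show ?case
    by (rule Ck_on_SucI[OF assms(1) has_derivative_add[OF Ck_on_has_derivative[OF Suc.prems(1)]
            Ck_on_has_derivative[OF Suc.prems(2)]]])
      (use Suc in auto)
qed

lemma Ck_on_sum:
  assumes "open S" "finite I" "\<And>i. i \<in> I \<Longrightarrow> Ck_on k S (f i)"
  shows "Ck_on k S (\<lambda>x. \<Sum>i\<in>I. f i x)"
  using assms(2,3) by (induction I rule: finite_induct) (auto intro!: Ck_on_const Ck_on_add assms(1))

text \<open>The Leibniz rule has two terms of the same bilinear shape, so the induction closes.
  Products, scalar multiples and the derivative of \<open>inverse\<close> are instances.\<close>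

lemma Ck_on_bilinear:
  assumes "open S" "bounded_bilinear h" "Ck_on k S f" "Ck_on k S g"
  shows "Ck_on k S (\<lambda>x. h (f x) (g x))"
  using assms(3,4)
proof (induction k arbitrary: f g)
  case 0
  then show ?case by (auto intro: bounded_bilinear.continuous_on[OF assms(2)])
next
  case (Suc k)
  show ?case
    by (rule Ck_on_SucI[OF assms(1) bounded_bilinear.FDERIV[OF assms(2)
          Ck_on_has_derivative[OF Suc.prems(1)] Ck_on_has_derivative[OF Suc.prems(2)]]])
      (use Suc Ck_on_Suc_imp[OF Suc.prems(1)] Ck_on_Suc_imp[OF Suc.prems(2)] assms(1)
        in \<open>auto intro!: Ck_on_add\<close>)
qed

lemma Ck_on_compose:
  fixes f :: "'b::euclidean_space \<Rightarrow> 'c::euclidean_space"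
    and g :: "'a::euclidean_space \<Rightarrow> 'b"
  assumes "open S" "open T" "g ` S \<subseteq> T" "Ck_on k T f" "Ck_on k S g"
  shows "Ck_on k S (\<lambda>x. f (g x))"
  using assms(4,5)
proof (induction k arbitrary: f)
  case 0
  then show ?case using assms(3) by (auto intro: continuous_on_compose2)
next
  case (Suc k)
  let ?f' = "\<lambda>x. frechet_derivative f (at x)" and ?g' = "\<lambda>x. frechet_derivative g (at x)"
  have der: "((\<lambda>x. f (g x)) has_derivative (\<lambda>v. ?f' (g x) (?g' x v))) (at x)" if "x \<in> S" for x
    using that assms(3) by (intro has_derivative_compose[OF Ck_on_has_derivative[OF Suc.prems(2) that]]
        Ck_on_has_derivative[OF Suc.prems(1)]) auto
  have "Ck_on k S (\<lambda>x. ?f' (g x) (?g' x v))" for v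
  proof -
    \<comment> \<open>The direction \<open>?g' x v\<close> varies with \<open>x\<close>, while the
      induction hypothesis is about a fixed direction; expanding in the basis separates the
      two.\<close>
    have eq: "(\<Sum>b\<in>Basis. (?g' x v \<bullet> b) *\<^sub>R ?f' (g x) b) = ?f' (g x) (?g' x v)" if "x \<in> S" for x
    proof -
      have "linear (?f' (g x))"
        using that assms(3) Suc.prems(1) by (intro linear_frechet_derivative) auto
      then have "?f' (g x) (\<Sum>b\<in>Basis. (?g' x v \<bullet> b) *\<^sub>R b)
          = (\<Sum>b\<in>Basis. (?g' x v \<bullet> b) *\<^sub>R ?f' (g x) b)"
        by (simp add: linear_sum linear_cmul)
      then show ?thesis by (simp add: euclidean_representation)
    qed
    have "Ck_on k S (\<lambda>x. \<Sum>b\<in>Basis. (?g' x v \<bullet> b) *\<^sub>R ?f' (g x) b)"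
    proof (intro Ck_on_sum Ck_on_bilinear[OF _ bounded_bilinear_scaleR]
        Ck_on_linear_comp[OF _ bounded_linear_inner_left] assms(1) finite_Basis)
      fix b :: 'b
      show "Ck_on k S (\<lambda>x. ?g' x v)"
        using Suc.prems(2) by simp
      show "Ck_on k S (\<lambda>x. ?f' (g x) b)"
        using Suc.IH[of "\<lambda>y. ?f' y b"] Suc.prems Ck_on_Suc_imp by auto
    qed
    then show ?thesis using Ck_on_cong[OF assms(1) eq] by simp
  qed
  then show ?case using Ck_on_SucI[OF assms(1) der] by blast
qed

lemma Ck_on_id: "open S \<Longrightarrow> Ck_on k S (\<lambda>x. x)"
  by (cases k) (auto intro!: Ck_on_const Ck_on_SucI[where D = "\<lambda>x v. v"] continuous_on_id)

lemma Ck_on_real_SucI: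
  fixes f :: "real \<Rightarrow> real"
  assumes "open S" "\<And>x. x \<in> S \<Longrightarrow> (f has_real_derivative f' x) (at x)" "Ck_on k S f'"
  shows "Ck_on (Suc k) S f"
  using assms
  by (intro Ck_on_SucI[where D = "\<lambda>x v. f' x * v"])
    (auto simp: has_field_derivative_def intro: Ck_on_linear_comp[OF _ bounded_linear_mult_left])

lemma smooth_on_real_derivative:
  fixes f :: "real \<Rightarrow> real"
  assumes "open S" "\<And>x. x \<in> S \<Longrightarrow> (f has_real_derivative f' x) (at x)" "smooth_on S f'"
  shows "smooth_on S f"
  using Ck_on_real_SucI[OF assms(1,2)] assms(3) Ck_on_Suc_imp unfolding smooth_on_def by blast

lemma smooth_on_cong:
  "open S \<Longrightarrow> (\<And>x. x \<in> S \<Longrightarrow> f x = g x) \<Longrightarrow> smooth_on S f \<Longrightarrow> smooth_on S g"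
  unfolding smooth_on_def using Ck_on_cong by blast

lemma smooth_on_subset: "smooth_on S f \<Longrightarrow> T \<subseteq> S \<Longrightarrow> smooth_on T f"
  unfolding smooth_on_def using Ck_on_subset by blast

lemma smooth_on_Un:
  "open S \<Longrightarrow> open T \<Longrightarrow> smooth_on S f \<Longrightarrow> smooth_on T f \<Longrightarrow> smooth_on (S \<union> T) f"
  unfolding smooth_on_def using Ck_on_Un by blast

lemma smooth_on_const: "smooth_on S (\<lambda>x. c)"
  unfolding smooth_on_def using Ck_on_const by blast

lemma smooth_on_id: "open S \<Longrightarrow> smooth_on S (\<lambda>x. x)"
  unfolding smooth_on_def using Ck_on_id by blast

lemma smooth_on_add:
  "open S \<Longrightarrow> smooth_on S f \<Longrightarrow> smooth_on S g \<Longrightarrow> smooth_on S (\<lambda>x. f x + g x)"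
  unfolding smooth_on_def using Ck_on_add by blast

lemma smooth_on_linear_comp:
  "open S \<Longrightarrow> bounded_linear h \<Longrightarrow> smooth_on S f \<Longrightarrow> smooth_on S (\<lambda>x. h (f x))"
  unfolding smooth_on_def using Ck_on_linear_comp by blast

lemma smooth_on_bilinear:
  "open S \<Longrightarrow> bounded_bilinear h \<Longrightarrow> smooth_on S f \<Longrightarrow> smooth_on S g \<Longrightarrow>
    smooth_on S (\<lambda>x. h (f x) (g x))"
  unfolding smooth_on_def using Ck_on_bilinear by blast

lemma smooth_on_compose:
  fixes f :: "'b::euclidean_space \<Rightarrow> 'c::euclidean_space"
    and g :: "'a::euclidean_space \<Rightarrow> 'b"
  shows "open S \<Longrightarrow> open T \<Longrightarrow> g ` S \<subseteq> T \<Longrightarrow> smooth_on T f \<Longrightarrow> smooth_on S g \<Longrightarrow>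
    smooth_on S (\<lambda>x. f (g x))"
  unfolding smooth_on_def using Ck_on_compose by blast

lemmas smooth_on_mult = smooth_on_bilinear[OF _ bounded_bilinear_mult]
  and smooth_on_scaleR = smooth_on_bilinear[OF _ bounded_bilinear_scaleR]
  and smooth_on_uminus = smooth_on_linear_comp[OF _ bounded_linear_minus[OF bounded_linear_ident]]

lemma smooth_on_diff:
  assumes "open S" "smooth_on S f" "smooth_on S g"
  shows "smooth_on S (\<lambda>x. f x - g x)"
  using smooth_on_add[OF assms(1,2) smooth_on_uminus[OF assms(1,3)]] by simp

lemma smooth_on_imp_continuous_on: "smooth_on S f \<Longrightarrow> continuous_on S f"
  unfolding smooth_on_def by (metis Ck_on.simps(1))

lemma smooth_on_imp_Ck_on: "smooth_on S f \<Longrightarrow> Ck_on k S f"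
  unfolding smooth_on_def by blast

lemma smooth_on_has_derivative:
  "smooth_on S f \<Longrightarrow> x \<in> S \<Longrightarrow> (f has_derivative frechet_derivative f (at x)) (at x)"
  using Ck_on_has_derivative smooth_on_imp_Ck_on by blast

lemma smooth_on_exp: "smooth_on UNIV (exp :: real \<Rightarrow> real)"
proof -
  have "Ck_on k UNIV (exp :: real \<Rightarrow> real)" for k
    by (induction k) (auto intro!: continuous_intros Ck_on_real_SucI derivative_eq_intros
        simp del: Ck_on.simps(2))
  then show ?thesis by (simp add: smooth_on_def)
qed

lemma smooth_on_sin_cos:
  "smooth_on UNIV (sin :: real \<Rightarrow> real)" "smooth_on UNIV (cos :: real \<Rightarrow> real)"
proof -
  have "Ck_on k UNIV (sin :: real \<Rightarrow> real) \<and> Ck_on k UNIV (cos :: real \<Rightarrow> real)" for k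
  proof (induction k)
    case (Suc k)
    have "Ck_on (Suc k) UNIV (sin :: real \<Rightarrow> real)"
      using Suc by (intro Ck_on_real_SucI[where f' = cos] DERIV_sin) auto
    moreover have "Ck_on (Suc k) UNIV (cos :: real \<Rightarrow> real)"
      using Suc Ck_on_linear_comp[OF open_UNIV bounded_linear_minus[OF bounded_linear_ident]]
      by (intro Ck_on_real_SucI[where f' = "\<lambda>x. - sin x"] DERIV_cos) auto
    ultimately show ?case by blast
  qed (auto intro: continuous_intros)
  then show "smooth_on UNIV (sin :: real \<Rightarrow> real)" "smooth_on UNIV (cos :: real \<Rightarrow> real)"
    by (simp_all add: smooth_on_def)
qed

text \<open>The derivative is again a product of values of \<open>inverse\<close>, which closes the
  induction. The real instance serves the step function and \<open>ln\<close>, the complex one the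
  inversion of the plane.\<close>

lemma smooth_on_inverse:
  fixes a :: "'a::{real_normed_field, euclidean_space}"
  shows "smooth_on (- {0}) (inverse :: 'a \<Rightarrow> 'a)"
proof -
  have "Ck_on k (- {0}) (inverse :: 'a \<Rightarrow> 'a)" for k
  proof (induction k)
    case 0
    then show ?case by (auto intro!: continuous_intros)
  next
    case (Suc k)
    show ?case
    proof (rule Ck_on_SucI[where D = "\<lambda>x v. - (inverse x * v * inverse x)"])
      fix v :: 'a
      show "Ck_on k (- {0}) (\<lambda>x. - (inverse x * v * inverse x))"
        by (intro Ck_on_linear_comp[OF _ bounded_linear_minus[OF bounded_linear_ident]]
            Ck_on_bilinear[OF _ bounded_bilinear_mult] Suc Ck_on_const) auto
    qed (auto intro!: has_derivative_inverse')
  qed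
  then show ?thesis by (simp add: smooth_on_def)
qed

lemma smooth_on_ln: "smooth_on {0<..} (ln :: real \<Rightarrow> real)"
  by (rule smooth_on_real_derivative[where f' = inverse])
    (auto intro!: derivative_eq_intros intro: smooth_on_subset[OF smooth_on_inverse]
      simp: field_simps)

section \<open>Swinging a link around an axis\<close>

text \<open>All exponents \<open>n\<close> are considered together because the span of these functions is closed under
  differentiation.\<close>

definition flat :: "nat \<Rightarrow> real \<Rightarrow> real" where
  "flat n x = (if x > 0 then inverse x ^ n * exp (- inverse x) else 0)"

text \<open>On the right, the substitution \<open>y = 1 / x\<close> turns the function into
  \<open>y ^ n / exp y\<close> with \<open>y\<close> tending to infinity.\<close>

lemma flat_tendsto_0: "(flat n \<longlongrightarrow> 0) (at 0)"
proof (rule filterlim_split_at)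
  have "((\<lambda>x::real. inverse x ^ n / exp (inverse x)) \<longlongrightarrow> 0) (at_right 0)"
    by (rule filterlim_compose[OF tendsto_power_div_exp_0 filterlim_inverse_at_top_right])
  moreover have "\<forall>\<^sub>F x in at_right 0. inverse x ^ n / exp (inverse x) = flat n x"
    using eventually_at_right_less[of 0]
    by eventually_elim (simp add: flat_def exp_minus divide_inverse)
  ultimately show "(flat n \<longlongrightarrow> 0) (at_right 0)"
    by (rule Lim_transform_eventually)
  have "\<forall>\<^sub>F x in at_left 0. flat n x = 0"
    by (simp add: eventually_at_filter flat_def)
  then show "(flat n \<longlongrightarrow> 0) (at_left 0)"
    using tendsto_eventually by blast
qed

lemma flat_has_derivative:
  "(flat n has_real_derivative - real n * flat (Suc n) x + flat (n + 2) x) (at x)"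
proof (cases x "0 :: real" rule: linorder_cases)
  case less
  have "((\<lambda>x. 0) has_real_derivative - real n * flat (Suc n) x + flat (n + 2) x) (at x)"
    using less by (auto intro!: derivative_eq_intros simp: flat_def)
  then show ?thesis
    by (rule has_field_derivative_transform_within_open[of _ _ _ "{..<0}"]) (use less in \<open>auto simp: flat_def\<close>)
next
  case equal
  \<comment> \<open>The difference quotient at 0 belongs to the same family, on both sides of 0, so
    its limit is already known.\<close>
  have "(\<lambda>h. (flat n (0 + h) - flat n 0) / h) = flat (Suc n)"
    by (auto simp: flat_def fun_eq_iff divide_inverse)
  then have "(flat n has_real_derivative 0) (at 0)"
    unfolding DERIV_def using flat_tendsto_0[of "Suc n"] by simp
  then show ?thesis using equal by (simp add: flat_def)
next
  case greater
  have d: "((\<lambda>x. inverse x ^ n) has_real_derivative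
      real n * (inverse x ^ (n - Suc 0) * - (inverse x ^ Suc (Suc 0)))) (at x)"
    using DERIV_power[OF DERIV_inverse[of x UNIV], of n] greater by (simp add: mult_ac)
  \<comment> \<open>For \<open>n = 0\<close> the truncated exponent \<open>n - Suc 0\<close> does no
    harm, since the factor \<open>real n\<close> vanishes.\<close>
  have eq: "real n * (inverse x ^ (n - Suc 0) * - (inverse x ^ Suc (Suc 0)))
      = - real n * inverse x ^ Suc n"
    by (cases n) (simp_all add: algebra_simps)
  note 1 = d[unfolded eq]
  have 2: "((\<lambda>x. exp (- inverse x)) has_real_derivative exp (- inverse x) * inverse x ^ 2) (at x)"
    using greater by (auto intro!: derivative_eq_intros simp: power2_eq_square)
  have 3: "- real n * inverse x ^ Suc n * exp (- inverse x)
        + exp (- inverse x) * inverse x ^ 2 * inverse x ^ n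
      = - real n * flat (Suc n) x + flat (n + 2) x"
  proof -
    have "- r * y ^ Suc n * e + e * y ^ 2 * y ^ n = - r * (y ^ Suc n * e) + y ^ (n + 2) * e"
      for r y e :: real
      by (simp add: power_add power2_eq_square algebra_simps)
    then show ?thesis
      using greater by (simp only: flat_def if_True)
  qed
  note DERIV_mult[OF 1 2, unfolded 3]
  then show ?thesis
    by (rule has_field_derivative_transform_within_open[of _ _ _ "{0<..}"]) (use greater in \<open>auto simp: flat_def\<close>)
qed

lemma smooth_on_flat: "smooth_on UNIV (flat n)"
proof -
  have "Ck_on k UNIV (flat n)" for k
  proof (induction k arbitrary: n)
    case 0
    then show ?case
      using DERIV_isCont[OF flat_has_derivative] by (simp add: continuous_on_eq_continuous_at)
  next
    case (Suc k)
    show ?case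
      by (rule Ck_on_real_SucI[OF open_UNIV flat_has_derivative])
        (intro Ck_on_add Ck_on_bilinear[OF _ bounded_bilinear_mult] Ck_on_const Suc open_UNIV)
  qed
  then show ?thesis by (simp add: smooth_on_def)
qed

definition smooth_step :: "real \<Rightarrow> real" where
  "smooth_step x = flat 0 (1 - x) * inverse (flat 0 (1 - x) + flat 0 x)"

lemma smooth_step_eq_1: "x \<le> 0 \<Longrightarrow> smooth_step x = 1"
  by (simp add: smooth_step_def flat_def)

lemma smooth_step_eq_0: "x \<ge> 1 \<Longrightarrow> smooth_step x = 0"
  by (simp add: smooth_step_def flat_def)

lemma smooth_on_smooth_step: "smooth_on UNIV smooth_step"
proof -
  \<comment> \<open>\<open>x\<close> and \<open>1 - x\<close> are never both nonpositive, so one of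
    the summands is positive.\<close>
  have pos: "flat 0 (1 - x) + flat 0 x > 0" for x
  proof (cases "x > 0")
    case True
    then have "flat 0 x > 0" "flat 0 (1 - x) \<ge> 0" by (simp_all add: flat_def)
    then show ?thesis by linarith
  next
    case False
    then show ?thesis by (simp add: flat_def)
  qed
  have nz: "flat 0 (1 - x) + flat 0 x \<noteq> 0" for x
    using pos[of x] by linarith
  have 1: "smooth_on UNIV (\<lambda>x. flat 0 (1 - x))"
    by (rule smooth_on_compose[OF open_UNIV open_UNIV _ smooth_on_flat])
      (simp_all add: smooth_on_diff smooth_on_const smooth_on_id)
  have "smooth_on UNIV (\<lambda>x. inverse (flat 0 (1 - x) + flat 0 x))"
    by (rule smooth_on_compose[OF open_UNIV _ _ smooth_on_inverse smooth_on_add])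
      (use nz in \<open>auto intro!: 1 smooth_on_flat\<close>)
  then show ?thesis
    unfolding smooth_step_def[abs_def] by (rule smooth_on_mult[OF open_UNIV 1])
qed

section \<open>Space as plane times height\<close>

definition emb :: "complex \<Rightarrow> real \<Rightarrow> real^3" where
  "emb z t = vector [Re z, Im z, t]"

lemma proj_emb [simp]: "proj (emb z t) = z"
  by (simp add: proj_def emb_def complex_eq_iff)

lemma height_emb [simp]: "height (emb z t) = t"
  by (simp add: height_def emb_def)

lemma emb_proj_height [simp]: "emb (proj p) (height p) = p"
  by (simp add: proj_def emb_def height_def Finite_Cartesian_Product.vec_eq_iff forall_3)

lemma space_eq_iff: "p = q \<longleftrightarrow> proj p = proj q \<and> height p = height q"
  by (metis emb_proj_height)

lemma bounded_linear_proj: "bounded_linear proj"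
proof -
  have "linear proj"
    by (intro linearI) (auto simp: proj_def complex_eq_iff)
  then show ?thesis by (simp add: linear_conv_bounded_linear)
qed

lemma bounded_linear_height: "bounded_linear height"
  unfolding height_def[abs_def] by (rule bounded_linear_vec_nth)

lemma bounded_linear_emb: "bounded_linear (\<lambda>x. emb (fst x) (snd x))"
proof -
  have "linear (\<lambda>x. emb (fst x) (snd x))"
    by (intro linearI) (auto simp: emb_def Finite_Cartesian_Product.vec_eq_iff forall_3)
  then show ?thesis by (simp add: linear_conv_bounded_linear)
qed

lemma emb_add: "emb z t + emb w s = emb (z + w) (t + s)"
  by (simp add: emb_def Finite_Cartesian_Product.vec_eq_iff forall_3)

lemma smooth_on_emb:
  assumes "open S" "smooth_on S f" "smooth_on S g"
  shows "smooth_on S (\<lambda>x. emb (f x) (g x))"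
proof -
  have 1: "smooth_on S (\<lambda>x. emb (f x) 0)"
    using bounded_linear_compose[OF bounded_linear_emb, of "\<lambda>z. (z, 0)"]
    by (intro smooth_on_linear_comp[OF assms(1) _ assms(2)])
      (simp add: bounded_linear_Pair bounded_linear_ident bounded_linear_zero)
  have 2: "smooth_on S (\<lambda>x. emb 0 (g x))"
    using bounded_linear_compose[OF bounded_linear_emb, of "\<lambda>t. (0, t)"]
    by (intro smooth_on_linear_comp[OF assms(1) _ assms(3)])
      (simp add: bounded_linear_Pair bounded_linear_ident bounded_linear_zero)
  show ?thesis
    using smooth_on_add[OF assms(1) 1 2] by (simp add: emb_add)
qed

lemma open_proj_neq: "open {p. proj p \<noteq> P}"
proof -
  have "{p. proj p \<noteq> P} = proj -` (- {P})" by auto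
  moreover have "open (proj -` (- {P}))"
    by (rule open_vimage[OF _ linear_continuous_on[OF bounded_linear_proj]])
      (rule open_Compl[OF closed_singleton])
  ultimately show ?thesis by simp
qed

lemmas smooth_on_proj = smooth_on_linear_comp[OF _ bounded_linear_proj]
  and smooth_on_height = smooth_on_linear_comp[OF _ bounded_linear_height]
  and smooth_on_Re = smooth_on_linear_comp[OF _ bounded_linear_Re]
  and smooth_on_Im = smooth_on_linear_comp[OF _ bounded_linear_Im]
  and smooth_on_cnj = smooth_on_linear_comp[OF _ bounded_linear_cnj]

section \<open>Rotations within the meridian half-planes\<close>

definition meridian :: "complex \<Rightarrow> real^3 \<Rightarrow> complex" where
  "meridian P p = Complex (ln (cmod (proj p - P))) (height p)"

text \<open>The squared modulus is smooth also where \<open>meridian P p\<close> vanishes, on the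
  circle of radius 1 around the axis at height 0; the modulus is not.\<close>

definition twist_angle :: "complex \<Rightarrow> real \<Rightarrow> real^3 \<Rightarrow> real" where
  "twist_angle P K p = pi * smooth_step ((cmod (meridian P p))\<^sup>2 - K)"

text \<open>In the coordinate \<open>u = ln \<bar>z - P\<bar> + \<i> t\<close> on the meridian half-planes this is a rotation, by
  \<open>c * pi\<close> for \<open>\<bar>u\<bar>\<^sup>2 \<le> K\<close> and by \<open>0\<close> for \<open>\<bar>u\<bar>\<^sup>2 \<ge> K + 1\<close>. The axis, on which \<open>u\<close> is a junk value,
  is fixed.\<close>

definition twist :: "complex \<Rightarrow> real \<Rightarrow> real \<Rightarrow> real^3 \<Rightarrow> real^3" where
  "twist P K c p =
     (if proj p = P then p
      else let u = meridian P p; u' = u * cis (c * twist_angle P K p)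
           in emb (P + exp (Re u' - Re u) *\<^sub>R (proj p - P)) (Im u'))"

lemma proj_twist_eq_iff [simp]: "proj (twist P K c p) = P \<longleftrightarrow> proj p = P"
  by (simp add: twist_def Let_def)

lemma meridian_twist:
  assumes "proj p \<noteq> P"
  shows "meridian P (twist P K c p) = meridian P p * cis (c * twist_angle P K p)"
  using assms
  by (intro complex_eqI) (simp_all add: meridian_def twist_def Let_def ln_mult)

text \<open>The angle depends only on the modulus of the meridian coordinate, which a rotation
  keeps. Hence the twists by \<open>c\<close> and \<open>- c\<close> turn each point by opposite
  angles and are mutually inverse.\<close>

lemma twist_angle_twist: "proj p \<noteq> P \<Longrightarrow> twist_angle P K (twist P K c p) = twist_angle P K p"
  by (simp add: twist_angle_def meridian_twist norm_mult)

lemma twist_twist: "twist P K (- c) (twist P K c p) = p"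
proof (cases "proj p = P")
  case False
  let ?q = "twist P K c p"
  have u: "meridian P ?q * cis (- c * twist_angle P K ?q) = meridian P p"
    using False by (simp add: meridian_twist twist_angle_twist mult.assoc cis_mult)
  have "proj ?q - P = exp (Re (meridian P ?q) - Re (meridian P p)) *\<^sub>R (proj p - P)"
    using False by (subst meridian_twist) (auto simp: twist_def Let_def)
  then have "exp (Re (meridian P p) - Re (meridian P ?q)) *\<^sub>R (proj ?q - P) = proj p - P"
    by (simp add: mult_exp_exp)
  moreover have "Im (meridian P p) = height p"
    by (simp add: meridian_def)
  ultimately show ?thesis
    using False unfolding twist_def[of P K "- c" ?q] Let_def u
    by (auto simp: space_eq_iff)
qed (simp add: twist_def)

lemma smooth_on_twist_away: "smooth_on {p. proj p \<noteq> P} (twist P K c)"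
proof -
  let ?S = "{p. proj p \<noteq> P}"
  note op = open_proj_neq[of P]
  define w where "w p = proj p - P" for p
  \<comment> \<open>Half the logarithm of the squared modulus is \<open>ln (cmod (w p))\<close>,
    written without norm and square root.\<close>
  define s where "s p = ln (Re (w p) * Re (w p) + Im (w p) * Im (w p)) * (1/2)" for p
  define a where "a p = c * (pi * smooth_step (s p * s p + height p * height p - K))" for p
  define u where "u p = s p * cos (a p) - height p * sin (a p)" for p
  define v where "v p = s p * sin (a p) + height p * cos (a p)" for p
  have [intro]: "smooth_on ?S w"
    unfolding w_def[abs_def] by (intro smooth_on_diff smooth_on_const smooth_on_proj smooth_on_id op)
  have [intro]: "smooth_on ?S height"
    by (intro smooth_on_height smooth_on_id op)
  have pos: "Re (w p) * Re (w p) + Im (w p) * Im (w p) > 0" if "p \<in> ?S" for p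
    using that by (auto simp: w_def complex_eq_iff sum_squares_gt_zero_iff)
  have [intro]: "smooth_on ?S s"
    unfolding s_def[abs_def]
    by (intro smooth_on_mult smooth_on_const smooth_on_compose[OF op _ _ smooth_on_ln] smooth_on_add
        smooth_on_Re smooth_on_Im op) (use pos in auto)
  have [intro]: "smooth_on ?S a"
    unfolding a_def[abs_def]
    by (intro smooth_on_mult smooth_on_const smooth_on_compose[OF op open_UNIV _ smooth_on_smooth_step]
        smooth_on_add smooth_on_diff op) auto
  have [intro]: "smooth_on ?S (\<lambda>p. cos (a p))" "smooth_on ?S (\<lambda>p. sin (a p))"
    by (auto intro!: smooth_on_compose[OF op open_UNIV _ smooth_on_sin_cos(1)]
        smooth_on_compose[OF op open_UNIV _ smooth_on_sin_cos(2)])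
  have [intro]: "smooth_on ?S u" "smooth_on ?S v"
    unfolding u_def[abs_def] v_def[abs_def]
    by (intro smooth_on_add smooth_on_diff smooth_on_mult op; blast)+
  have 1: "smooth_on ?S (\<lambda>p. emb (P + exp (u p - s p) *\<^sub>R w p) (v p))"
    by (intro smooth_on_emb smooth_on_add smooth_on_const smooth_on_scaleR
        smooth_on_compose[OF op open_UNIV _ smooth_on_exp] smooth_on_diff op) auto
  have "emb (P + exp (u p - s p) *\<^sub>R w p) (v p) = twist P K c p" if "p \<in> ?S" for p
  proof -
    have "s p = ln (cmod (w p))"
      using pos[OF that] by (simp add: s_def cmod_def power2_eq_square ln_sqrt)
    then have m: "meridian P p = Complex (s p) (height p)"
      by (simp add: meridian_def w_def)
    have "a p = c * twist_angle P K p"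
      by (simp add: a_def twist_angle_def m complex_norm sum_power2_ge_zero power2_eq_square[symmetric])
    then show ?thesis
      using that by (simp add: twist_def Let_def m u_def v_def w_def)
  qed
  then show ?thesis
    using smooth_on_cong[OF op _ 1] by simp
qed

text \<open>Close to the axis the logarithm of the distance lies below \<open>- (K + 1)\<close>, so
  its square is at least \<open>(K + 1)\<^sup>2\<close>, hence at least \<open>K + 1\<close>,
  whatever the height: the angle has dropped to 0. This makes the twist smooth across the
  axis.\<close>

lemma twist_eq_id_near_axis:
  assumes "K \<ge> 0" "cmod (proj p - P) < exp (- (K + 1))"
  shows "twist P K c p = p"
proof (cases "proj p = P")
  case False
  define s where "s = ln (cmod (proj p - P))"
  have "s < - (K + 1)"
    using assms(2) False ln_less_cancel_iff[of "cmod (proj p - P)" "exp (- (K + 1))"]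
    by (simp add: s_def)
  then have "K + 1 \<le> - s" by simp
  then have "(K + 1) * 1 \<le> (- s) * (- s)"
    using assms(1) by (intro mult_mono) auto
  then have "s\<^sup>2 \<ge> K + 1"
    by (simp add: power2_eq_square)
  moreover have "(cmod (meridian P p))\<^sup>2 = s\<^sup>2 + (height p)\<^sup>2"
    by (simp add: meridian_def s_def cmod_power2)
  ultimately have "(cmod (meridian P p))\<^sup>2 - K \<ge> 1"
    using zero_le_power2[of "height p"] by linarith
  then show ?thesis
    using False by (simp add: twist_def twist_angle_def smooth_step_eq_0 space_eq_iff meridian_def)
qed (simp add: twist_def)

lemma smooth_on_twist:
  assumes "K \<ge> 0"
  shows "smooth_on UNIV (twist P K c)"
proof -
  let ?A = "{p. proj p \<noteq> P}" and ?B = "{p. cmod (proj p - P) < exp (- (K + 1))}"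
  have "continuous_on UNIV (\<lambda>p. cmod (proj p - P))"
    using linear_continuous_on[OF bounded_linear_proj] by (auto intro!: continuous_intros)
  then have op: "open ?B"
    by (intro open_Collect_less continuous_on_const)
  have "smooth_on ?B (twist P K c)"
    by (rule smooth_on_cong[OF op _ smooth_on_id[OF op]]) (simp add: twist_eq_id_near_axis[OF assms])
  from smooth_on_Un[OF open_proj_neq op smooth_on_twist_away this]
  have "smooth_on (?A \<union> ?B) (twist P K c)" .
  moreover have "?A \<union> ?B = UNIV" by auto
  ultimately show ?thesis by simp
qed

section \<open>The half turn, the inversion and the swing\<close>

definition half_turn :: "complex \<Rightarrow> real^3 \<Rightarrow> real^3" where
  "half_turn P p = emb (P + cnj (proj p - P)) (- height p)"

lemma half_turn_half_turn [simp]: "half_turn P (half_turn P p) = p"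
  by (simp add: half_turn_def)

lemma smooth_on_half_turn: "smooth_on UNIV (half_turn P)"
  unfolding half_turn_def[abs_def]
  by (intro smooth_on_emb smooth_on_add smooth_on_const smooth_on_cnj smooth_on_diff smooth_on_proj
      smooth_on_uminus smooth_on_height smooth_on_id open_UNIV)

text \<open>By the convention \<open>inverse 0 = 0\<close> the centre is a fixed point, which makes
  this an involution of the whole plane.\<close>

definition invert :: "complex \<Rightarrow> complex \<Rightarrow> complex" where
  "invert P z = P + inverse (z - P)"

definition lift_invert :: "complex \<Rightarrow> real^3 \<Rightarrow> real^3" where
  "lift_invert P p = emb (invert P (proj p)) (height p)"

definition swing :: "complex \<Rightarrow> real \<Rightarrow> real^3 \<Rightarrow> real^3" where
  "swing P K p = twist P K 1 (half_turn P p)"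

text \<open>Put \<open>w = proj p - P\<close>. The half turn leads to radius \<open>cmod w\<close>,
  direction \<open>cnj w\<close> and height \<open>- height p\<close>; the rotation by
  \<open>pi\<close> negates the logarithm of the radius and the height. The result lies over
  \<open>P + cnj w / (cmod w)\<^sup>2\<close>, which is \<open>P + 1 / w\<close>, at the original
  height.\<close>

lemma swing_eq_lift_invert:
  assumes "proj p \<noteq> P" "(cmod (meridian P p))\<^sup>2 \<le> K"
  shows "swing P K p = lift_invert P p"
proof -
  define w where "w = proj p - P"
  have w: "w \<noteq> 0" using assms(1) by (simp add: w_def)
  have m: "meridian P (half_turn P p) = Complex (ln (cmod w)) (- height p)"
    by (simp add: meridian_def half_turn_def w_def del: complex_cnj_diff)
  have "twist_angle P K (half_turn P p) = pi"
    using assms(2) by (simp add: twist_angle_def m smooth_step_eq_1)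
      (simp add: meridian_def w_def cmod_power2 smooth_step_eq_1)
  then have "swing P K p = emb (P + exp (- 2 * ln (cmod w)) *\<^sub>R cnj w) (height p)"
    using w by (simp add: swing_def twist_def m) (simp add: half_turn_def w_def)
  also have "exp (- 2 * ln (cmod w)) = inverse ((cmod w)\<^sup>2)"
    using w by (simp add: exp_minus exp_double)
  also have "inverse ((cmod w)\<^sup>2) *\<^sub>R cnj w = inverse w"
    using w by (simp add: inverse_complex_def complex_eq_iff cmod_power2 divide_inverse)
  finally show ?thesis by (simp add: lift_invert_def invert_def w_def)
qed

section \<open>The action on link types\<close>

text \<open>The chain rule for \<open>G' (G x) = x\<close> makes the Jacobian determinant nonzero
  everywhere; it is continuous on a connected space, so its sign at one point decides.\<close>

lemma smooth_diffeo_det_pos: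
  fixes G G' :: "real^3 \<Rightarrow> real^3"
  assumes G: "smooth_on UNIV G" and G': "smooth_on UNIV G'" and inv: "\<And>x. G' (G x) = x"
    and pos: "Determinants.det (matrix (frechet_derivative G (at x0))) > 0"
  shows "Determinants.det (matrix (frechet_derivative G (at x))) > 0"
proof -
  define d where "d x = Determinants.det (matrix (frechet_derivative G (at x)))" for x
  have "continuous_on UNIV (\<lambda>x. frechet_derivative G (at x) v)" for v
    using smooth_on_imp_Ck_on[OF G, of "Suc 0"] by simp
  then have "continuous_on UNIV (\<lambda>x. frechet_derivative G (at x) v $ i)" for v i
    by (intro continuous_on_component)
  then have cont: "continuous_on UNIV d"
    unfolding d_def[abs_def] Determinants.det_def matrix_def
    by (simp add: continuous_on_sum continuous_on_mult continuous_on_prod continuous_on_const)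
  have nz: "d x \<noteq> 0" for x
  proof -
    let ?D = "frechet_derivative G (at x)" and ?E = "frechet_derivative G' (at (G x))"
    have D: "(G has_derivative ?D) (at x)" and E: "(G' has_derivative ?E) (at (G x))"
      using smooth_on_has_derivative G G' by blast+
    have "((\<lambda>x. x) has_derivative (\<lambda>v. ?E (?D v))) (at x)"
      using has_derivative_compose[OF D E] by (simp add: inv)
    then have "(\<lambda>v. ?E (?D v)) = (\<lambda>v. v)"
      using has_derivative_unique has_derivative_ident by blast
    moreover have "matrix (?E \<circ> ?D) = matrix ?E ** matrix ?D"
      using has_derivative_linear[OF D] has_derivative_linear[OF E] by (rule matrix_compose)
    ultimately have "matrix ?E ** matrix ?D = Finite_Cartesian_Product.mat 1"
      using matrix_id_mat_1 by (metis (no_types, lifting) comp_def eq_id_iff)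
    then have "Determinants.det (matrix ?E) * d x = 1"
      unfolding d_def by (metis Determinants.det_I Determinants.det_mul)
    then show ?thesis by auto
  qed
  have "d x > 0"
  proof (rule ccontr)
    assume "\<not> d x > 0"
    then have "0 \<in> range d"
      using connectedD_interval[of "range d" "d x" "d x0" 0] pos
        connected_continuous_image[OF cont connected_UNIV] by (auto simp: d_def)
    then show False using nz by fastforce
  qed
  then show ?thesis by (simp add: d_def)
qed

lemma piecewise_smooth_autohomeo_compose:
  assumes h: "piecewise_smooth_autohomeo h"
    and G: "smooth_on UNIV G" and G': "smooth_on UNIV G'"
    and inv: "\<And>x. G' (G x) = x" "\<And>x. G (G' x) = x"
  shows "piecewise_smooth_autohomeo (\<lambda>x. G (h x))"
proof -
  obtain k where k: "homeomorphism UNIV UNIV h k" "piecewise_smooth h" "piecewise_smooth k"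
    using h unfolding piecewise_smooth_autohomeo_def by blast
  have cont: "continuous_on UNIV h" "continuous_on UNIV k" "continuous_on UNIV G" "continuous_on UNIV G'"
    using k(1) G G' by (auto simp: homeomorphism_def intro: smooth_on_imp_continuous_on)
  have "homeomorphism UNIV UNIV G G'"
    using cont inv by (auto simp: homeomorphism_def image_iff) metis+
  from homeomorphism_compose[OF k(1) this]
  have hom: "homeomorphism UNIV UNIV (\<lambda>x. G (h x)) (\<lambda>x. k (G' x))"
    by (simp add: o_def)
  have "piecewise_smooth (\<lambda>x. G (h x))"
    unfolding piecewise_smooth_def
  proof (intro conjI allI)
    show "continuous_on UNIV (\<lambda>x. G (h x))"
      using hom by (simp add: homeomorphism_def)
    fix x
    obtain U F where U: "open U" "x \<in> U" "finite F" "\<forall>g\<in>F. smooth_on U g" "\<forall>y\<in>U. \<exists>g\<in>F. h y = g y"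
      using k(2) unfolding piecewise_smooth_def by blast
    have "smooth_on U (\<lambda>y. G (g y))" if "g \<in> F" for g
      using U(1,4) that by (intro smooth_on_compose[OF _ open_UNIV _ G]) auto
    then have "finite ((\<lambda>g y. G (g y)) ` F)" "\<forall>g\<in>(\<lambda>g y. G (g y)) ` F. smooth_on U g"
      "\<forall>y\<in>U. \<exists>g\<in>(\<lambda>g y. G (g y)) ` F. G (h y) = g y"
      using U(3,5) by (auto, metis)
    then show "\<exists>U F. open U \<and> x \<in> U \<and> finite F \<and> (\<forall>g\<in>F. smooth_on U g) \<and>
        (\<forall>y\<in>U. \<exists>g\<in>F. G (h y) = g y)"
      using U(1,2) by blast
  qed
  moreover have "piecewise_smooth (\<lambda>x. k (G' x))"
    unfolding piecewise_smooth_def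
  proof (intro conjI allI)
    show "continuous_on UNIV (\<lambda>x. k (G' x))"
      using hom by (simp add: homeomorphism_def)
    fix x
    obtain U F where U: "open U" "G' x \<in> U" "finite F" "\<forall>g\<in>F. smooth_on U g"
      "\<forall>y\<in>U. \<exists>g\<in>F. k y = g y"
      using k(3) unfolding piecewise_smooth_def by blast
    have op: "open (G' -` U)"
      using open_vimage[OF U(1)] cont(4) by blast
    have "smooth_on (G' -` U) (\<lambda>y. g (G' y))" if "g \<in> F" for g
      using U(4) that by (intro smooth_on_compose[OF op U(1) _ _ smooth_on_subset[OF G' subset_UNIV]]) auto
    then have "finite ((\<lambda>g y. g (G' y)) ` F)" "\<forall>g\<in>(\<lambda>g y. g (G' y)) ` F. smooth_on (G' -` U) g"
      "\<forall>y\<in>G' -` U. \<exists>g\<in>(\<lambda>g y. g (G' y)) ` F. k (G' y) = g y"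
      using U(3,5) by auto
    then show "\<exists>U F. open U \<and> x \<in> U \<and> finite F \<and> (\<forall>g\<in>F. smooth_on U g) \<and>
        (\<forall>y\<in>U. \<exists>g\<in>F. k (G' y) = g y)"
      using op U(2) by blast
  qed
  ultimately show ?thesis
    using hom unfolding piecewise_smooth_autohomeo_def by blast
qed

lemma orientation_preserving_compose:
  assumes h: "orientation_preserving h"
    and G: "smooth_on UNIV G" and G': "smooth_on UNIV G'"
    and inv: "\<And>x. G' (G x) = x"
    and pos: "\<And>x. Determinants.det (matrix (frechet_derivative G (at x))) > 0"
  shows "orientation_preserving (\<lambda>x. G (h x))"
  unfolding orientation_preserving_def
proof (intro allI impI)
  fix x
  assume "(\<lambda>x. G (h x)) differentiable (at x)"
  then obtain D where "((\<lambda>x. G (h x)) has_derivative D) (at x)"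
    by (auto simp: differentiable_def)
  \<comment> \<open>\<open>h\<close> is \<open>G'\<close> after the composite, so it is
    differentiable wherever the composite is, and the hypothesis on \<open>h\<close>
    applies.\<close>
  from has_derivative_compose[OF this smooth_on_has_derivative[OF G' UNIV_I]]
  have "h differentiable (at x)"
    by (auto simp: inv differentiable_def)
  then have H: "(h has_derivative frechet_derivative h (at x)) (at x)"
    and posH: "Determinants.det (matrix (frechet_derivative h (at x))) > 0"
    using h by (auto simp: frechet_derivative_works orientation_preserving_def)
  have DG: "(G has_derivative frechet_derivative G (at (h x))) (at (h x))"
    using smooth_on_has_derivative[OF G UNIV_I] .
  have "frechet_derivative (\<lambda>x. G (h x)) (at x)
      = frechet_derivative G (at (h x)) \<circ> frechet_derivative h (at x)"
    using frechet_derivative_at[OF has_derivative_compose[OF H DG]] by (simp add: o_def)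
  moreover have "matrix (frechet_derivative G (at (h x)) \<circ> frechet_derivative h (at x))
      = matrix (frechet_derivative G (at (h x))) ** matrix (frechet_derivative h (at x))"
    using has_derivative_linear[OF H] has_derivative_linear[OF DG] by (rule matrix_compose)
  ultimately show "Determinants.det (matrix (frechet_derivative (\<lambda>x. G (h x)) (at x))) > 0"
    using posH pos[of "h x"] by (simp add: Determinants.det_mul)
qed

text \<open>Phrased with a witness \<open>h\<close> instead of membership in
  \<open>link_type\<close>, so that images can be chained before they are known to be links.\<close>

lemma link_type_image:
  fixes G :: "real^3 \<Rightarrow> real^3"
  assumes "\<exists>h. piecewise_smooth_autohomeo h \<and> orientation_preserving h \<and> h ` L = M"
    and "smooth_on UNIV G" "smooth_on UNIV G'" "\<And>x. G' (G x) = x" "\<And>x. G (G' x) = x"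
    and "\<And>x. Determinants.det (matrix (frechet_derivative G (at x))) > 0"
  shows "\<exists>h. piecewise_smooth_autohomeo h \<and> orientation_preserving h \<and> h ` L = G ` M"
proof -
  obtain h where "piecewise_smooth_autohomeo h" "orientation_preserving h" "h ` L = M"
    using assms(1) by blast
  then show ?thesis
    using piecewise_smooth_autohomeo_compose[OF _ assms(2-5)]
      orientation_preserving_compose[OF _ assms(2-4,6)]
    by (intro exI[of _ "\<lambda>x. G (h x)"]) (auto simp: image_image)
qed

lemma link_type_rotate:
  assumes "\<exists>h. piecewise_smooth_autohomeo h \<and> orientation_preserving h \<and> h ` L = M"
    and A: "orthogonal_transformation A" "Determinants.det (matrix A) = 1"
  shows "\<exists>h. piecewise_smooth_autohomeo h \<and> orientation_preserving h \<and> h ` L = A ` M"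
proof (rule link_type_image[OF assms(1)])
  have bl: "bounded_linear A" "bounded_linear (Hilbert_Choice.inv A)"
    using A(1) orthogonal_transformation_inv[OF A(1)]
    by (simp_all add: orthogonal_transformation_linear linear_linear)
  show "smooth_on UNIV A" "smooth_on UNIV (Hilbert_Choice.inv A)"
    using bl smooth_on_linear_comp[OF open_UNIV _ smooth_on_id] by blast+
  have "bij A" using A(1) by (rule orthogonal_transformation_bij)
  then show "Hilbert_Choice.inv A (A x) = x" "A (Hilbert_Choice.inv A x) = x" for x
    by (simp_all add: bij_is_inj bij_is_surj surj_f_inv_f)
  show "Determinants.det (matrix (frechet_derivative A (at x))) > 0" for x
    using A(2) frechet_derivative_at[OF bounded_linear_imp_has_derivative[OF bl(1)], of x] by simp
qed

definition unswing :: "complex \<Rightarrow> real \<Rightarrow> real^3 \<Rightarrow> real^3" where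
  "unswing P K p = half_turn P (twist P K (- 1) p)"

lemma unswing_swing: "unswing P K (swing P K p) = p"
  by (simp add: unswing_def swing_def twist_twist)

lemma swing_unswing: "swing P K (unswing P K p) = p"
  using twist_twist[of P K "-1" p] by (simp add: unswing_def swing_def)

lemma smooth_on_swing: "K \<ge> 0 \<Longrightarrow> smooth_on UNIV (swing P K)"
  unfolding swing_def[abs_def]
  by (rule smooth_on_compose[OF open_UNIV open_UNIV _ smooth_on_twist smooth_on_half_turn]) auto

lemma smooth_on_unswing: "K \<ge> 0 \<Longrightarrow> smooth_on UNIV (unswing P K)"
  unfolding unswing_def[abs_def]
  by (rule smooth_on_compose[OF open_UNIV open_UNIV _ smooth_on_half_turn smooth_on_twist]) auto

text \<open>Around the axis the twist is the identity and the swing is the half turn, whose linear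
  part is diagonal with entries \<open>1, -1, -1\<close>. The determinant 1 at
  \<open>emb P 0\<close> settles the sign everywhere.\<close>

lemma swing_det_pos:
  assumes "K \<ge> 0"
  shows "Determinants.det (matrix (frechet_derivative (swing P K) (at x))) > 0"
proof (rule smooth_diffeo_det_pos[OF smooth_on_swing[OF assms] smooth_on_unswing[OF assms] unswing_swing])
  let ?N = "{p. cmod (proj p - P) < exp (- (K + 1))}"
  define J where "J p = emb (cnj (proj p)) (- height p)" for p
  have "continuous_on UNIV (\<lambda>p. cmod (proj p - P))"
    using linear_continuous_on[OF bounded_linear_proj] by (auto intro!: continuous_intros)
  then have op: "open ?N"
    by (intro open_Collect_less continuous_on_const)
  have "linear J"
    using linear_compose[OF bounded_linear.linear[OF bounded_linear_proj]]
    by (intro linearI) (simp_all add: J_def space_eq_iff bounded_linear.linear linear_add linear_scale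
        bounded_linear_proj bounded_linear_height)
  then have "(J has_derivative J) (at (emb P 0))"
    by (simp add: linear_imp_has_derivative)
  then have "((\<lambda>p. emb (P - cnj P) 0 + J p) has_derivative J) (at (emb P 0))"
    by (auto intro!: derivative_eq_intros)
  moreover have "emb (P - cnj P) 0 + J p = swing P K p" if "p \<in> ?N" for p
  proof -
    have "cmod (proj (half_turn P p) - P) = cmod (proj p - P)"
      by (simp add: half_turn_def del: complex_cnj_diff)
    then have "swing P K p = half_turn P p"
      using that assms by (simp add: swing_def twist_eq_id_near_axis)
    then show ?thesis
      by (simp add: J_def half_turn_def emb_add algebra_simps)
  qed
  ultimately have "(swing P K has_derivative J) (at (emb P 0))"
    using has_derivative_transform_within_open[OF _ op] by fastforce
  then have "frechet_derivative (swing P K) (at (emb P 0)) = J"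
    using frechet_derivative_at by metis
  moreover have "Determinants.det (matrix J) = 1"
    by (simp add: det_3 matrix_def J_def emb_def proj_def height_def axis_def)
  ultimately show "Determinants.det (matrix (frechet_derivative (swing P K) (at (emb P 0)))) > 0"
    by simp
qed

lemma link_type_lift_invert:
  assumes "\<exists>h. piecewise_smooth_autohomeo h \<and> orientation_preserving h \<and> h ` L = M"
    and "compact M" "P \<notin> proj ` M"
  shows "\<exists>h. piecewise_smooth_autohomeo h \<and> orientation_preserving h \<and> h ` L = lift_invert P ` M"
proof -
  \<comment> \<open>On a compact set that misses the axis the meridian coordinate is bounded; a
    bound of its squared modulus serves as \<open>K\<close>.\<close>
  have "continuous_on M (\<lambda>p. (ln (cmod (proj p - P)))\<^sup>2 + (height p)\<^sup>2)"
    using assms(3) linear_continuous_on[OF bounded_linear_proj]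
      linear_continuous_on[OF bounded_linear_height]
    by (intro continuous_intros) auto
  then have "continuous_on M (\<lambda>p. (cmod (meridian P p))\<^sup>2)"
    by (simp add: meridian_def cmod_power2)
  then have "bounded ((\<lambda>p. (cmod (meridian P p))\<^sup>2) ` M)"
    using assms(2) compact_continuous_image compact_imp_bounded by blast
  then obtain K where K: "K > 0" "\<And>p. p \<in> M \<Longrightarrow> (cmod (meridian P p))\<^sup>2 \<le> K"
    by (auto simp: bounded_pos)
  have "swing P K ` M = lift_invert P ` M"
    using assms(3) K(2) by (intro image_cong refl swing_eq_lift_invert) auto
  moreover have "\<exists>h. piecewise_smooth_autohomeo h \<and> orientation_preserving h \<and> h ` L = swing P K ` M"
    using K(1) by (intro link_type_image[OF assms(1), of _ "unswing P K"] smooth_on_swing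
        smooth_on_unswing unswing_swing swing_unswing swing_det_pos) auto
  ultimately show ?thesis by simp
qed

section \<open>Inverted links and regions\<close>

lemma smooth_involution_derivative_eq_0:
  fixes f :: "'a::euclidean_space \<Rightarrow> 'a"
  assumes "open S" "smooth_on S f" "f ` S \<subseteq> S" "\<And>x. x \<in> S \<Longrightarrow> f (f x) = x" "x \<in> S"
    and "frechet_derivative f (at x) v = 0"
  shows "v = 0"
proof -
  have D: "(f has_derivative frechet_derivative f (at x)) (at x)"
    and E: "(f has_derivative frechet_derivative f (at (f x))) (at (f x))"
    using assms by (auto intro!: smooth_on_has_derivative)
  \<comment> \<open>Differentiating \<open>f (f x) = x\<close> exhibits the derivative at
    \<open>f x\<close> as a left inverse of the one at \<open>x\<close>.\<close>
  have "((\<lambda>x. f (f x)) has_derivative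
      (\<lambda>v. frechet_derivative f (at (f x)) (frechet_derivative f (at x) v))) (at x)"
    by (rule has_derivative_compose[OF D E])
  then have "((\<lambda>x. x) has_derivative
      (\<lambda>v. frechet_derivative f (at (f x)) (frechet_derivative f (at x) v))) (at x)"
    by (rule has_derivative_transform_within_open[OF _ assms(1,5,4)])
  then have "(\<lambda>v. frechet_derivative f (at (f x)) (frechet_derivative f (at x) v)) = (\<lambda>v. v)"
    using has_derivative_unique has_derivative_ident by blast
  then have "v = frechet_derivative f (at (f x)) (frechet_derivative f (at x) v)"
    by metis
  also have "\<dots> = 0"
    using assms(6) has_derivative_linear[OF E] by (simp add: linear_0)
  finally show ?thesis .
qed

lemma smooth_curve_image_derivative:
  fixes f :: "'a::euclidean_space \<Rightarrow> 'b::euclidean_space"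
  assumes "smooth_on S f" "g t \<in> S" "(g has_vector_derivative v) (at t)"
  shows "((\<lambda>t. f (g t)) has_vector_derivative frechet_derivative f (at (g t)) v) (at t)"
proof -
  have D: "(f has_derivative frechet_derivative f (at (g t))) (at (g t))"
    using smooth_on_has_derivative assms(1,2) by blast
  have "((\<lambda>t. f (g t)) has_derivative (\<lambda>r. frechet_derivative f (at (g t)) (r *\<^sub>R v))) (at t)"
    using has_derivative_compose[OF assms(3)[unfolded has_vector_derivative_def] D] .
  then show ?thesis
    using has_derivative_linear[OF D] by (simp add: has_vector_derivative_def linear_scale)
qed

lemma piecewise_smooth_curve_image:
  fixes f :: "'a::euclidean_space \<Rightarrow> 'b::euclidean_space"
  assumes S: "open S" and f: "smooth_on S f"
    and inj: "\<And>x v. x \<in> S \<Longrightarrow> frechet_derivative f (at x) v = 0 \<Longrightarrow> v = 0"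
    and c: "piecewise_smooth_curve c" "path_image c \<subseteq> S"
  shows "piecewise_smooth_curve (f \<circ> c)"
proof -
  have path: "path c" using c(1) by (simp add: piecewise_smooth_curve_def)
  obtain T where T: "finite T" "{0, 1} \<subseteq> T" "T \<subseteq> {0..1}"
    and pieces: "\<And>a b. a \<in> T \<Longrightarrow> b \<in> T \<Longrightarrow> a < b \<and> {a<..<b} \<inter> T = {} \<Longrightarrow>
         \<exists>V g. open V \<and> {a..b} \<subseteq> V \<and> smooth_on V g \<and>
            (\<forall>t\<in>{a..b}. c t = g t \<and> vector_derivative g (at t) \<noteq> 0)"
    using c(1) unfolding piecewise_smooth_curve_def by metis
  have "path (f \<circ> c)"
    using path_continuous_image[OF path]
      continuous_on_subset[OF smooth_on_imp_continuous_on[OF f] c(2)] by blast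
  moreover have "\<exists>V h. open V \<and> {a..b} \<subseteq> V \<and> smooth_on V h \<and>
      (\<forall>t\<in>{a..b}. (f \<circ> c) t = h t \<and> vector_derivative h (at t) \<noteq> 0)"
    if ab: "a \<in> T" "b \<in> T" "a < b \<and> {a<..<b} \<inter> T = {}" for a b
  proof -
    obtain V g where V: "open V" "{a..b} \<subseteq> V" and g: "smooth_on V g"
      and cg: "\<And>t. t \<in> {a..b} \<Longrightarrow> c t = g t \<and> vector_derivative g (at t) \<noteq> 0"
      using pieces[OF ab] by blast
    have "{a..b} \<subseteq> {0..1}"
      using ab T(3) by fastforce
    then have gS: "g t \<in> S" if "t \<in> {a..b}" for t
      using that cg[OF that] c(2) unfolding path_image_def by (metis image_subset_iff subsetD)
    \<comment> \<open>The smooth extension \<open>g\<close> of the piece may leave \<open>S\<close>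
      outside \<open>{a..b}\<close>, so its domain is cut down.\<close>
    define W where "W = V \<inter> g -` S"
    have W: "open W" "{a..b} \<subseteq> W"
      using continuous_open_preimage[OF smooth_on_imp_continuous_on[OF g] V(1) S] V(2) gS
      by (auto simp: W_def)
    have gW: "smooth_on W g"
      using g by (rule smooth_on_subset) (auto simp: W_def)
    have "smooth_on W (\<lambda>t. f (g t))"
      by (rule smooth_on_compose[OF W(1) S _ f gW]) (auto simp: W_def)
    moreover have "(f \<circ> c) t = f (g t) \<and> vector_derivative (\<lambda>t. f (g t)) (at t) \<noteq> 0"
      if t: "t \<in> {a..b}" for t
    proof -
      have "(g has_derivative frechet_derivative g (at t)) (at t)"
        using smooth_on_has_derivative[OF gW] W(2) t by blast
      then have "(g has_vector_derivative vector_derivative g (at t)) (at t)"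
        using vector_derivative_works differentiable_def by blast
      from vector_derivative_at[OF smooth_curve_image_derivative[OF f gS[OF t] this]]
      show ?thesis
        using cg[OF t] inj[OF gS[OF t]] by auto
    qed
    ultimately show ?thesis using W by blast
  qed
  ultimately show ?thesis
    using T unfolding piecewise_smooth_curve_def by metis
qed

lemma tangent_vector_image:
  assumes "open S" "smooth_on S f" "L \<subseteq> S"
    and inj: "\<And>x v. x \<in> S \<Longrightarrow> frechet_derivative f (at x) v = 0 \<Longrightarrow> v = 0"
    and "tangent_vector L p v"
  shows "tangent_vector (f ` L) (f p) (frechet_derivative f (at p) v)"
proof -
  obtain g e where v: "v \<noteq> 0" and e: "e > 0" and g: "smooth_on {-e<..<e} g" "g ` {-e<..<e} \<subseteq> L"
    and p: "g 0 = p" and der: "(g has_vector_derivative v) (at 0)"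
    using assms(5) unfolding tangent_vector_def by blast
  have "p \<in> S" using p g(2) e assms(3) by fastforce
  moreover have "smooth_on {-e<..<e} (\<lambda>t. f (g t))"
    using g assms(1-3) by (intro smooth_on_compose[OF _ assms(1) _ assms(2) g(1)]) auto
  moreover have "((\<lambda>t. f (g t)) has_vector_derivative frechet_derivative f (at p) v) (at 0)"
    using smooth_curve_image_derivative[OF assms(2) _ der] \<open>p \<in> S\<close> p by simp
  ultimately show ?thesis
    unfolding tangent_vector_def using e g(2) p v inj[of p v]
    by (intro conjI exI[of _ "\<lambda>t. f (g t)"] exI[of _ e]) auto
qed

lemma link_parametrization_image:
  fixes f :: "real^3 \<Rightarrow> real^3"
  assumes S: "open S" and f: "smooth_on S f"
    and inj: "\<And>x v. x \<in> S \<Longrightarrow> frechet_derivative f (at x) v = 0 \<Longrightarrow> v = 0"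
    and "L \<subseteq> S" "inj_on f L" and \<Gamma>: "link_parametrization \<Gamma> L"
  shows "link_parametrization ((\<circ>) f ` \<Gamma>) (f ` L)"
proof -
  have L: "L = (\<Union>\<gamma>\<in>\<Gamma>. path_image \<gamma>)"
    and disj: "pairwise (\<lambda>\<gamma> \<delta>. path_image \<gamma> \<inter> path_image \<delta> = {}) \<Gamma>"
    and \<Gamma>': "finite \<Gamma>" "\<Gamma> \<noteq> {}"
    using \<Gamma> unfolding link_parametrization_def by blast+
  have "simple_path (f \<circ> \<gamma>) \<and> pathfinish (f \<circ> \<gamma>) = pathstart (f \<circ> \<gamma>) \<and> piecewise_smooth_curve (f \<circ> \<gamma>)"
    if "\<gamma> \<in> \<Gamma>" for \<gamma>
  proof -
    have \<gamma>: "simple_path \<gamma>" "pathfinish \<gamma> = pathstart \<gamma>" "piecewise_smooth_curve \<gamma>"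
      using that \<Gamma> unfolding link_parametrization_def by blast+
    have sub: "path_image \<gamma> \<subseteq> L" using that L by blast
    have "simple_path (f \<circ> \<gamma>)"
      using sub assms(4,5) smooth_on_imp_continuous_on[OF f]
      by (intro simple_path_continuous_image[OF \<gamma>(1)])
        (blast intro: continuous_on_subset inj_on_subset)+
    moreover have "piecewise_smooth_curve (f \<circ> \<gamma>)"
      using sub assms(4) by (intro piecewise_smooth_curve_image[OF S f inj \<gamma>(3)]) auto
    ultimately show ?thesis
      using \<gamma>(2) by (simp add: pathfinish_compose pathstart_compose)
  qed
  moreover have "pairwise (\<lambda>\<gamma> \<delta>. path_image \<gamma> \<inter> path_image \<delta> = {}) ((\<circ>) f ` \<Gamma>)"
  proof (rule pairwiseI, clarify)
    fix \<gamma> \<delta> assume *: "\<gamma> \<in> \<Gamma>" "\<delta> \<in> \<Gamma>" "f \<circ> \<gamma> \<noteq> f \<circ> \<delta>"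
    then have "path_image \<gamma> \<inter> path_image \<delta> = {}"
      using pairwiseD[OF disj, of \<gamma> \<delta>] by metis
    moreover have "path_image \<gamma> \<subseteq> L" "path_image \<delta> \<subseteq> L" using * L by blast+
    ultimately show "path_image (f \<circ> \<gamma>) \<inter> path_image (f \<circ> \<delta>) = {}"
      using inj_on_image_Int[OF assms(5)] by (metis image_empty path_image_compose)
  qed
  moreover have "f ` L = (\<Union>\<gamma>\<in>(\<circ>) f ` \<Gamma>. path_image \<gamma>)"
    by (auto simp: L path_image_compose)
  ultimately show ?thesis
    using \<Gamma>' unfolding link_parametrization_def by blast
qed

lemma compact_link:
  assumes "link_parametrization \<Gamma> L"
  shows "compact L"
proof -
  have "compact (path_image \<gamma>)" if "\<gamma> \<in> \<Gamma>" for \<gamma>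
    using that assms unfolding link_parametrization_def
    by (metis compact_path_image simple_path_imp_path)
  then show ?thesis
    using assms unfolding link_parametrization_def by auto
qed

section \<open>Inversion of the plane and its lift to space\<close>

lemma invert_invert [simp]: "invert P (invert P z) = z"
  by (simp add: invert_def)

lemma invert_center [simp]: "invert P P = P"
  by (simp add: invert_def)

lemma invert_eq_center_iff [simp]: "invert P z = P \<longleftrightarrow> z = P"
  by (simp add: invert_def)

lemma center_eq_invert_iff [simp]: "P = invert P z \<longleftrightarrow> z = P"
  by (metis invert_eq_center_iff)

lemma inj_invert: "inj (invert P)"
  by (metis injI invert_invert)

lemma invert_image_iff: "z \<in> invert P ` S \<longleftrightarrow> invert P z \<in> S"
  by (metis image_iff invert_invert)

lemma smooth_on_invert: "smooth_on (- {P}) (invert P)"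
  unfolding invert_def[abs_def]
  by (intro smooth_on_add smooth_on_const smooth_on_compose[OF _ _ _ smooth_on_inverse]
      smooth_on_diff smooth_on_id) auto

lemma invert_has_field_derivative:
  "z \<noteq> P \<Longrightarrow> (invert P has_field_derivative - ((inverse (z - P))\<^sup>2)) (at z)"
  unfolding invert_def[abs_def]
  by (auto intro!: derivative_eq_intros simp: power2_eq_square)

lemma continuous_on_invert: "P \<notin> S \<Longrightarrow> continuous_on S (invert P)"
  using continuous_on_subset[OF smooth_on_imp_continuous_on[OF smooth_on_invert]] by blast

lemma proj_lift_invert [simp]: "proj (lift_invert P p) = invert P (proj p)"
  by (simp add: lift_invert_def)

lemma height_lift_invert [simp]: "height (lift_invert P p) = height p"
  by (simp add: lift_invert_def)

lemma lift_invert_lift_invert [simp]: "lift_invert P (lift_invert P p) = p"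
  by (simp add: space_eq_iff)

lemma inj_lift_invert: "inj (lift_invert P)"
  by (metis injI lift_invert_lift_invert)

lemma lift_invert_image_iff: "p \<in> lift_invert P ` L \<longleftrightarrow> lift_invert P p \<in> L"
  by (metis image_iff lift_invert_lift_invert)

lemma smooth_on_lift_invert: "smooth_on {p. proj p \<noteq> P} (lift_invert P)"
  unfolding lift_invert_def[abs_def]
  by (intro smooth_on_emb smooth_on_height smooth_on_compose[OF _ _ _ smooth_on_invert] smooth_on_proj
      smooth_on_id open_proj_neq) auto

lemma invert_derivative_eq_0:
  "z \<in> - {P} \<Longrightarrow> frechet_derivative (invert P) (at z) v = 0 \<Longrightarrow> v = 0"
  by (rule smooth_involution_derivative_eq_0[OF _ smooth_on_invert, of P z]) auto

lemma lift_invert_derivative_eq_0: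
  "p \<in> {p. proj p \<noteq> P} \<Longrightarrow> frechet_derivative (lift_invert P) (at p) v = 0 \<Longrightarrow> v = 0"
  by (rule smooth_involution_derivative_eq_0[OF open_proj_neq smooth_on_lift_invert, of P p]) auto

text \<open>Conformality: the factor depends on \<open>proj p\<close> only, so at a crossing the
  directions of both strands are multiplied by the same complex number. It results from
  differentiating \<open>proj (lift_invert P p) = invert P (proj p)\<close> in two ways.\<close>

lemma proj_lift_invert_derivative:
  assumes "proj p \<noteq> P"
  shows "proj (frechet_derivative (lift_invert P) (at p) v) = - ((inverse (proj p - P))\<^sup>2) * proj v"
proof -
  have "(lift_invert P has_derivative frechet_derivative (lift_invert P) (at p)) (at p)"
    using smooth_on_has_derivative[OF smooth_on_lift_invert] assms by blast
  from bounded_linear.has_derivative[OF bounded_linear_proj this]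
  have "((\<lambda>p. invert P (proj p)) has_derivative
      (\<lambda>v. proj (frechet_derivative (lift_invert P) (at p) v))) (at p)"
    by simp
  moreover have "((\<lambda>p. invert P (proj p)) has_derivative
      (\<lambda>v. - ((inverse (proj p - P))\<^sup>2) * proj v)) (at p)"
    using has_derivative_compose[OF bounded_linear_imp_has_derivative[OF bounded_linear_proj]
        invert_has_field_derivative[OF assms, unfolded has_field_derivative_def]] .
  ultimately show ?thesis
    using has_derivative_unique by metis
qed

lemma fibre_lift_invert:
  "{p \<in> lift_invert P ` L. proj p = c} = lift_invert P ` {p \<in> L. proj p = invert P c}"
  by (auto simp: lift_invert_image_iff)

lemma card_fibre_lift_invert:
  "card {p \<in> lift_invert P ` L. proj p = c} = card {p \<in> L. proj p = invert P c}"
  unfolding fibre_lift_invert using inj_lift_invert by (intro card_image) (blast intro: inj_on_subset)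

lemma tangent_vector_lift_invert:
  assumes "P \<notin> proj ` L" "tangent_vector L p v"
  shows "tangent_vector (lift_invert P ` L) (lift_invert P p)
    (frechet_derivative (lift_invert P) (at p) v)"
  using assms(1)
  by (intro tangent_vector_image[OF open_proj_neq smooth_on_lift_invert _
        lift_invert_derivative_eq_0 assms(2)]) auto

text \<open>\<open>Im (cnj a * b)\<close> is the oriented area spanned by \<open>a\<close> and
  \<open>b\<close>. A common nonzero factor rotates and scales, so transversality and the sign that
  determines the Goeritz index survive.\<close>

lemma Im_cnj_mult_scale: "Im (cnj (l * a) * (l * b)) = (cmod l)\<^sup>2 * Im (cnj a * b)"
proof -
  have "cnj (l * a) * (l * b) = of_real ((cmod l)\<^sup>2) * (cnj a * b)"
    using complex_norm_square[of l] by (simp add: mult_ac)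
  moreover have "Im (of_real r * z) = r * Im z" for r z by simp
  ultimately show ?thesis by metis
qed

lemma regular_projection_lift_invert:
  assumes reg: "regular_projection L" and P: "P \<notin> proj ` L"
  shows "regular_projection (lift_invert P ` L)"
  unfolding regular_projection_def
proof (intro conjI allI ballI impI)
  obtain \<Gamma> where \<Gamma>: "link_parametrization \<Gamma> L" "\<And>\<gamma>. \<gamma> \<in> \<Gamma> \<Longrightarrow> piecewise_smooth_curve (proj \<circ> \<gamma>)"
    using reg unfolding regular_projection_def by blast
  have "link_parametrization ((\<circ>) (lift_invert P) ` \<Gamma>) (lift_invert P ` L)"
    using P inj_lift_invert
    by (intro link_parametrization_image[OF open_proj_neq smooth_on_lift_invert
          lift_invert_derivative_eq_0 _ _ \<Gamma>(1)]) (auto intro: inj_on_subset)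
  moreover have "piecewise_smooth_curve (proj \<circ> (lift_invert P \<circ> \<gamma>))" if "\<gamma> \<in> \<Gamma>" for \<gamma>
  proof -
    have "path_image \<gamma> \<subseteq> L" using \<Gamma>(1) that unfolding link_parametrization_def by blast
    then have "path_image (proj \<circ> \<gamma>) \<subseteq> - {P}"
      using P by (auto simp: path_image_compose)
    then have "piecewise_smooth_curve (invert P \<circ> (proj \<circ> \<gamma>))"
      by (intro piecewise_smooth_curve_image[OF _ smooth_on_invert invert_derivative_eq_0 \<Gamma>(2)[OF that]])
        auto
    moreover have "proj \<circ> (lift_invert P \<circ> \<gamma>) = invert P \<circ> (proj \<circ> \<gamma>)"
      by (simp add: fun_eq_iff)
    ultimately show ?thesis by simp
  qed
  ultimately show "\<exists>\<Gamma>. link_parametrization \<Gamma> (lift_invert P ` L) \<and>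
      (\<forall>\<gamma>\<in>\<Gamma>. piecewise_smooth_curve (proj \<circ> \<gamma>))"
    by blast
  fix c
  show "finite {p \<in> lift_invert P ` L. proj p = c}"
    using reg unfolding fibre_lift_invert regular_projection_def by blast
  show "card {p \<in> lift_invert P ` L. proj p = c} \<le> 2"
    using reg unfolding card_fibre_lift_invert regular_projection_def by blast
next
  have fin: "finite {c. card {p \<in> L. proj p = c} = 2}"
    using reg unfolding regular_projection_def by blast
  have "{c. card {p \<in> lift_invert P ` L. proj p = c} = 2}
      = invert P -` {c. card {p \<in> L. proj p = c} = 2}"
    by (auto simp: card_fibre_lift_invert)
  then show "finite {c. card {p \<in> lift_invert P ` L. proj p = c} = 2}"
    using finite_vimageI[OF fin inj_invert] by simp
next
  fix p q assume pq: "p \<in> lift_invert P ` L" "q \<in> lift_invert P ` L" "p \<noteq> q \<and> proj p = proj q"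
  define p' q' where "p' = lift_invert P p" and "q' = lift_invert P q"
  have p': "p' \<in> L" "q' \<in> L" "p' \<noteq> q'" "proj p' = proj q'"
    using pq by (auto simp: p'_def q'_def dest: arg_cong[of _ _ "lift_invert P"])
  then obtain v w where vw: "tangent_vector L p' v" "tangent_vector L q' w" "Im (cnj (proj v) * proj w) \<noteq> 0"
    using reg unfolding regular_projection_def by blast
  have pp: "proj p' \<noteq> P" "proj q' \<noteq> P" using p' P by auto
  let ?v = "frechet_derivative (lift_invert P) (at p') v"
    and ?w = "frechet_derivative (lift_invert P) (at q') w"
  have "tangent_vector (lift_invert P ` L) p ?v" "tangent_vector (lift_invert P ` L) q ?w"
    using tangent_vector_lift_invert[OF P vw(1)] tangent_vector_lift_invert[OF P vw(2)]
    by (simp_all add: p'_def q'_def)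
  moreover have "Im (cnj (proj ?v) * proj ?w) \<noteq> 0"
    unfolding proj_lift_invert_derivative[OF pp(1)] proj_lift_invert_derivative[OF pp(2)] p'(4)
      Im_cnj_mult_scale
    using vw(3) pp(2) by simp
  ultimately show "\<exists>v w. tangent_vector (lift_invert P ` L) p v \<and> tangent_vector (lift_invert P ` L) q w \<and>
      Im (cnj (proj v) * proj w) \<noteq> 0"
    by blast
qed

section \<open>Regions, closures and frontiers under inversion\<close>

text \<open>The image of a region under inversion of the Riemann sphere, with \<open>P\<close> and \<open>\<infinity>\<close> interchanged.\<close>

definition flip :: "complex \<Rightarrow> complex set \<Rightarrow> complex set" where
  "flip P S = invert P ` (S - {P}) \<union> (if bounded S then {} else {P})"

lemma mem_flip_iff: "z \<in> flip P S \<longleftrightarrow> (if z = P then \<not> bounded S else invert P z \<in> S)"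
  by (auto simp: flip_def invert_image_iff)

lemma flip_mono: "S \<subseteq> T \<Longrightarrow> flip P S \<subseteq> flip P T"
  using bounded_subset[of T S] by (auto simp: mem_flip_iff subset_iff)

text \<open>Inversion takes distance \<open>r\<close> from \<open>P\<close> to distance
  \<open>1 / r\<close>, so points escaping to infinity become points accumulating at
  \<open>P\<close>.\<close>

lemma bounded_iff_center_not_in_closure:
  "\<not> bounded S \<longleftrightarrow> P \<in> closure (invert P ` (S - {P}))"
proof
  assume unb: "\<not> bounded S"
  show "P \<in> closure (invert P ` (S - {P}))"
    unfolding closure_approachable
  proof (intro allI impI)
    fix e :: real assume e: "e > 0"
    obtain z where z: "z \<in> S" "dist P z > inverse e"
      using unb unfolding bounded_any_center[of S P] by (metis not_le_imp_less)
    have "z \<noteq> P" using z(2) e by (auto dest: less_imp_not_less)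
    moreover have "dist (invert P z) P < e"
      using less_imp_inverse_less[OF z(2)] e
      by (simp add: invert_def dist_norm norm_inverse norm_minus_commute)
    ultimately show "\<exists>y\<in>invert P ` (S - {P}). dist y P < e" using z(1) by blast
  qed
next
  assume cl: "P \<in> closure (invert P ` (S - {P}))"
  show "\<not> bounded S"
  proof
    assume "bounded S"
    then obtain B where B: "\<And>z. z \<in> S \<Longrightarrow> dist P z \<le> B"
      unfolding bounded_any_center[of S P] by blast
    define B' where "B' = max B 1"
    have "inverse B' > 0" by (simp add: B'_def)
    then obtain z where z: "z \<in> S" "z \<noteq> P" "dist (invert P z) P < inverse B'"
      using cl unfolding closure_approachable by blast
    have "inverse (cmod (z - P)) < inverse B'"
      using z(3) by (simp add: invert_def dist_norm norm_inverse)
    then have "B' < cmod (z - P)"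
      using z(2) inverse_less_imp_less by fastforce
    then show False using B[OF z(1)] by (simp add: B'_def dist_norm norm_minus_commute)
  qed
qed

text \<open>An open connected subset of the plane stays connected without \<open>P\<close>, and the
  image gains the point \<open>P\<close> only if \<open>P\<close> lies in its closure.\<close>

lemma connected_flip:
  assumes "open S" "connected S"
  shows "connected (flip P S)"
proof -
  have "connected (invert P ` (S - {P}))"
    using connected_open_delete[OF assms, of P] continuous_on_invert[of P "S - {P}"]
    by (intro connected_continuous_image) auto
  then show ?thesis
    using bounded_iff_center_not_in_closure[of S P] closure_subset[of "invert P ` (S - {P})"]
    by (elim connected_intermediate_closure) (auto simp: flip_def)
qed

text \<open>Unboundedness of the flip means that \<open>S\<close> accumulates at \<open>P\<close>.
  Some ball around \<open>P\<close> is free of \<open>U\<close>, and a region that meets this ball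
  contains it, so only the region of \<open>P\<close> itself qualifies.\<close>

lemma unbounded_flip:
  assumes U: "closed U" "P \<notin> U" and S: "S \<in> components (- U)"
  shows "\<not> bounded (flip P S) \<longleftrightarrow> P \<in> S"
proof -
  have "invert P ` (flip P S - {P}) = S - {P}"
    by (rule Set.set_eqI) (simp add: invert_image_iff mem_flip_iff)
  then have 1: "\<not> bounded (flip P S) \<longleftrightarrow> P \<in> closure (S - {P})"
    using bounded_iff_center_not_in_closure[of "flip P S" P] by simp
  have "open S" using open_components[OF _ S] U(1) by auto
  show ?thesis
  proof
    assume "\<not> bounded (flip P S)"
    then have cl: "P \<in> closure (S - {P})" using 1 by simp
    obtain e where e: "e > 0" "ball P e \<subseteq> - U"
      using U by (meson ComplI open_Compl open_contains_ball)
    obtain y where "y \<in> S - {P}" "dist y P < e"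
      using cl e(1) unfolding closure_approachable by blast
    then have "S \<inter> ball P e \<noteq> {}" by (auto simp: dist_commute)
    then have "ball P e \<subseteq> S"
      using components_maximal[OF S connected_ball e(2)] by blast
    then show "P \<in> S" using e(1) by auto
  next
    assume "P \<in> S"
    then have "P islimpt S" using \<open>open S\<close> interior_limit_point interior_open by blast
    then show "\<not> bounded (flip P S)" using 1 islimpt_in_closure by blast
  qed
qed

text \<open>Off \<open>P\<close> this is the involution \<open>invert P\<close>. At \<open>P\<close>
  it relies on \<open>S\<close> being a region: a punctured disc around \<open>P\<close> would have
  its centre filled in.\<close>

lemma flip_flip:
  assumes "closed U" "P \<notin> U" "S \<in> components (- U)"
  shows "flip P (flip P S) = S"
  using unbounded_flip[OF assms] by (auto simp: mem_flip_iff split: if_splits)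

text \<open>The flip of \<open>S\<close> is connected and so lies in some region \<open>C\<close>.
  The flip of \<open>C\<close> is connected too and meets \<open>S\<close>, hence lies in
  \<open>S\<close>; flipping back gives \<open>C \<subseteq> flip P S\<close>.\<close>

lemma flip_component:
  assumes U: "compact U" "P \<notin> U" and S: "S \<in> components (- U)"
  shows "flip P S \<in> components (- invert P ` U)"
proof -
  let ?U' = "invert P ` U"
  have U': "compact ?U'" "P \<notin> ?U'"
    using U continuous_on_invert by (auto intro: compact_continuous_image simp: invert_image_iff)
  have sub: "flip P T \<subseteq> - invert P ` V" if "P \<notin> V" "T \<subseteq> - V" for V T
    using that by (auto simp: mem_flip_iff invert_image_iff split: if_splits)
  have open_comp: "open T" if "compact V" "T \<in> components (- V)" for V T :: "complex set"
    using open_components[OF _ that(2)] compact_imp_closed[OF that(1)] by auto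
  have conn: "connected (flip P S)"
    using connected_flip open_comp[OF U(1) S] in_components_connected[OF S] by blast
  have subS: "flip P S \<subseteq> - ?U'"
    using sub[OF U(2)] in_components_subset[OF S] by blast
  \<comment> \<open>A nonempty open set is not a singleton, so it has a point other than
    \<open>P\<close>, and \<open>flip P\<close> acts on this point as
    \<open>invert P\<close>.\<close>
  obtain z where z: "z \<in> S" "z \<noteq> P"
    using open_comp[OF U(1) S] in_components_nonempty[OF S]
    by (metis is_singletonI' is_singleton_def not_open_singleton ex_in_conv)
  then have fz: "invert P z \<in> flip P S" by (simp add: mem_flip_iff)
  obtain C where C: "C \<in> components (- ?U')" "flip P S \<subseteq> C"
    using exists_component_superset[OF subS _ conn] fz subS by blast
  have "flip P C \<subseteq> - U"
    using sub[OF U'(2) in_components_subset[OF C(1)]] by (simp add: image_image)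
  moreover have "connected (flip P C)"
    using connected_flip open_comp[OF U'(1) C(1)] in_components_connected[OF C(1)] by blast
  moreover have "z \<in> flip P C"
    using subsetD[OF C(2) fz] z(2) by (simp add: mem_flip_iff)
  then have "S \<inter> flip P C \<noteq> {}"
    using z(1) by blast
  ultimately have "flip P C \<subseteq> S"
    using components_maximal[OF S] by blast
  then have "flip P (flip P C) \<subseteq> flip P S" by (rule flip_mono)
  then have "C = flip P S"
    using C(2) flip_flip[OF compact_imp_closed[OF U'(1)] U'(2) C(1)] by blast
  then show ?thesis using C(1) by simp
qed

text \<open>The same maximality argument, used for edges; as \<open>P\<close> is not in
  \<open>E\<close>, plain images take the place of \<open>flip\<close>.\<close>

lemma invert_component:
  assumes "P \<notin> E" "e \<in> components E"
  shows "invert P ` e \<in> components (invert P ` E)"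
proof -
  have sub: "e \<subseteq> E" "e \<noteq> {}"
    using in_components_subset[OF assms(2)] in_components_nonempty[OF assms(2)] .
  have "continuous_on e (invert P)"
    using sub(1) assms(1) by (intro continuous_on_invert) blast
  then have conn: "connected (invert P ` e)"
    using connected_continuous_image in_components_connected[OF assms(2)] by blast
  obtain C where C: "C \<in> components (invert P ` E)" "invert P ` e \<subseteq> C"
    using exists_component_superset[OF image_mono[OF sub(1)] _ conn] sub by blast
  have CE: "C \<subseteq> invert P ` E" using C(1) by (rule in_components_subset)
  then have "P \<notin> C" using assms(1) invert_image_iff[of P P E] by auto
  then have "connected (invert P ` C)"
    using continuous_on_invert in_components_connected[OF C(1)] connected_continuous_image by blast
  moreover have "invert P ` C \<subseteq> E"
    using image_mono[OF CE, of "invert P"] by (simp add: image_image)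
  moreover have "e \<subseteq> invert P ` C"
    using image_mono[OF C(2), of "invert P"] by (simp add: image_image)
  ultimately have "invert P ` C \<subseteq> e"
    using components_maximal[OF assms(2), of "invert P ` C"] sub(2) by blast
  from image_mono[OF this, of "invert P"] have "C \<subseteq> invert P ` e"
    by (simp add: image_image)
  then have "C = invert P ` e" using C(2) by blast
  then show ?thesis using C(1) by simp
qed

lemma closure_flip:
  assumes "x \<in> closure S" "x \<noteq> P"
  shows "invert P x \<in> closure (flip P S)"
proof -
  \<comment> \<open>Removing \<open>P\<close> from \<open>S\<close> affects the closure at most at
    \<open>P\<close>.\<close>
  have "x \<in> closure (insert P (S - {P}))"
    using assms(1) closure_mono[of S "insert P (S - {P})"] by blast
  then have "x \<in> closure (S - {P})"
    using assms(2) unfolding closure_insert by blast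
  then obtain y where y: "\<And>n. y n \<in> S - {P}" "y \<longlonglongrightarrow> x"
    unfolding closure_sequential by blast
  have "isCont (invert P) x"
    using continuous_on_eq_continuous_at[of "- {P}"] continuous_on_invert[of P "- {P}"] assms(2) by auto
  then have "(\<lambda>n. invert P (y n)) \<longlonglongrightarrow> invert P x"
    using y(2) isCont_tendsto_compose by blast
  moreover have "invert P (y n) \<in> flip P S" for n
    using y(1)[of n] by (auto simp: mem_flip_iff)
  ultimately show ?thesis
    unfolding closure_sequential by (intro exI[of _ "\<lambda>n. invert P (y n)"]) blast
qed

lemma frontier_flip:
  assumes "compact U" "P \<notin> U" "S \<in> components (- U)" "x \<in> frontier S" "x \<noteq> P"
  shows "invert P x \<in> frontier (flip P S)"
proof -
  have "open S" "open (flip P S)"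
    using assms(1-3) flip_component[OF assms(1-3)] continuous_on_invert[OF assms(2)]
      open_components[of "- U" S] open_components[of "- invert P ` U" "flip P S"]
    by (auto simp: compact_imp_closed compact_continuous_image open_Compl)
  then show ?thesis
    using assms(4,5) closure_flip[of x S P] by (auto simp: frontier_def interior_open mem_flip_iff)
qed

section \<open>Tangent directions\<close>

text \<open>Bouligand's contingent cone.\<close>

definition contingent :: "'a::real_normed_vector set \<Rightarrow> 'a \<Rightarrow> 'a \<Rightarrow> bool" where
  "contingent S c d \<longleftrightarrow>
     (\<exists>x t. (\<forall>n. x n \<in> S \<and> t n > 0) \<and> t \<longlonglongrightarrow> 0 \<and> (\<lambda>n. (x n - c) /\<^sub>R t n) \<longlonglongrightarrow> d)"

lemma contingentI:
  assumes "\<forall>\<^sub>F n in sequentially. x n \<in> S \<and> t n > 0" "t \<longlonglongrightarrow> 0" "(\<lambda>n. (x n - c) /\<^sub>R t n) \<longlonglongrightarrow> d"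
  shows "contingent S c d"
proof -
  obtain N where "\<And>n. n \<ge> N \<Longrightarrow> x n \<in> S \<and> t n > 0"
    using assms(1) unfolding eventually_sequentially by blast
  then show ?thesis
    unfolding contingent_def
    using LIMSEQ_ignore_initial_segment[OF assms(2), of N] LIMSEQ_ignore_initial_segment[OF assms(3), of N]
    by (intro exI[of _ "\<lambda>n. x (n + N)"] exI[of _ "\<lambda>n. t (n + N)"]) simp
qed

lemma contingent_tendsto:
  fixes x :: "nat \<Rightarrow> 'a::real_normed_vector"
  assumes "\<And>n. t n > 0" "t \<longlonglongrightarrow> 0" "(\<lambda>n. (x n - c) /\<^sub>R t n) \<longlonglongrightarrow> d"
  shows "x \<longlonglongrightarrow> c"
proof -
  have "(\<lambda>n. c + t n *\<^sub>R ((x n - c) /\<^sub>R t n)) \<longlonglongrightarrow> c + 0 *\<^sub>R d"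
    using assms(2,3) by (intro tendsto_intros)
  moreover have "c + t n *\<^sub>R ((x n - c) /\<^sub>R t n) = x n" for n
    using assms(1)[of n] by simp
  ultimately show ?thesis by simp
qed

lemma contingent_in_closure: "contingent S c d \<Longrightarrow> c \<in> closure S"
  unfolding contingent_def closure_sequential using contingent_tendsto by metis

lemma contingent_infinite:
  assumes "infinite {n. x n \<in> A}" "\<And>n. t n > 0" "t \<longlonglongrightarrow> 0" "(\<lambda>n. (x n - c) /\<^sub>R t n) \<longlonglongrightarrow> d"
  shows "contingent A c d"
proof -
  obtain r :: "nat \<Rightarrow> nat" where r: "strict_mono r" "\<And>n. r n \<in> {n. x n \<in> A}"
    using infinite_enumerate[OF assms(1)] by blast
  show ?thesis
    unfolding contingent_def
    using r(2) assms(2) LIMSEQ_subseq_LIMSEQ[OF assms(3) r(1)] LIMSEQ_subseq_LIMSEQ[OF assms(4) r(1)]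
    by (intro exI[of _ "x \<circ> r"] exI[of _ "t \<circ> r"]) (simp add: o_def)
qed

lemma contingent_Un:
  assumes "contingent (A \<union> B) c d"
  shows "contingent A c d \<or> contingent B c d"
proof -
  obtain x t where xt: "\<And>n. x n \<in> A \<union> B" "\<And>n. t n > 0" "t \<longlonglongrightarrow> 0" "(\<lambda>n. (x n - c) /\<^sub>R t n) \<longlonglongrightarrow> d"
    using assms unfolding contingent_def by blast
  have "{n. x n \<in> A} \<union> {n. x n \<in> B} = UNIV" using xt(1) by blast
  then have "infinite {n. x n \<in> A} \<or> infinite {n. x n \<in> B}"
    by (metis finite_Un infinite_UNIV_nat)
  then show ?thesis using contingent_infinite xt(2-4) by blast
qed

text \<open>A closed set missing \<open>c\<close> contains no sequence tending to \<open>c\<close>.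
  This discards all parts of a link away from the point considered.\<close>

lemma contingent_Un_far:
  assumes "contingent (A \<union> B) c d" "closed B" "c \<notin> B"
  shows "contingent A c d"
  using contingent_Un[OF assms(1)] contingent_in_closure[of B c d] assms(2,3) by auto

lemma has_vector_derivative_quotient:
  assumes "(f has_vector_derivative v) (at a within I)"
  shows "((\<lambda>s. (f s - f a) /\<^sub>R (s - a)) \<longlongrightarrow> v) (at a within I)"
proof -
  have "((\<lambda>s. norm (f s - (f a + (s - a) *\<^sub>R v)) / norm (s - a)) \<longlongrightarrow> 0) (at a within I)"
    using assms unfolding has_vector_derivative_def has_derivative_iff_norm
    by (simp add: diff_diff_eq)
  moreover have "\<forall>\<^sub>F s in at a within I.
      norm (f s - (f a + (s - a) *\<^sub>R v)) / norm (s - a) = norm ((f s - f a) /\<^sub>R (s - a) - v)"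
    unfolding eventually_at_filter
  proof (intro always_eventually allI impI)
    fix s assume "s \<noteq> a"
    then have "(f s - f a) /\<^sub>R (s - a) - v = (f s - (f a + (s - a) *\<^sub>R v)) /\<^sub>R (s - a)"
      by (simp add: diff_diff_eq[symmetric] scaleR_right_diff_distrib)
    then show "norm (f s - (f a + (s - a) *\<^sub>R v)) / norm (s - a) = norm ((f s - f a) /\<^sub>R (s - a) - v)"
      by (simp add: divide_inverse mult.commute)
  qed
  ultimately have "((\<lambda>s. norm ((f s - f a) /\<^sub>R (s - a) - v)) \<longlongrightarrow> 0) (at a within I)"
    by (rule Lim_transform_eventually)
  then show ?thesis
    using tendsto_norm_zero_iff Lim_null by blast
qed

text \<open>Points of the arc approaching \<open>f a\<close> have parameters approaching
  \<open>a\<close>, by compactness of \<open>I\<close> and because \<open>f a\<close> is attained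
  only there. Their secants take the direction of \<open>v\<close> or \<open>- v\<close>; the sign
  \<open>\<epsilon>\<close> tells on which side of \<open>a\<close> the parameters lie.\<close>

lemma contingent_arc:
  fixes f :: "real \<Rightarrow> 'a::real_normed_vector"
  assumes der: "(f has_vector_derivative v) (at a within I)" "v \<noteq> 0"
    and I: "compact I" "continuous_on I f" and inj: "\<And>s. s \<in> I \<Longrightarrow> f s = f a \<Longrightarrow> s = a"
    and side: "\<And>s. s \<in> I \<Longrightarrow> 0 \<le> \<epsilon> * (s - a)" "\<bar>\<epsilon>\<bar> = 1"
    and d: "contingent (f ` I) (f a) d"
  shows "\<exists>r\<ge>0. d = r *\<^sub>R (\<epsilon> *\<^sub>R v)"
proof (cases "d = 0")
  case True
  then show ?thesis by auto
next
  case False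
  obtain x t where "\<And>n. x n \<in> f ` I" and t0: "\<And>n. t n > 0" "t \<longlonglongrightarrow> 0"
    and lim0: "(\<lambda>n. (x n - f a) /\<^sub>R t n) \<longlonglongrightarrow> d"
    using d unfolding contingent_def by blast
  then have "\<forall>n. \<exists>s\<in>I. x n = f s" by blast
  then obtain s0 where s0: "\<And>n. s0 n \<in> I" "\<And>n. x n = f (s0 n)" by metis
  obtain l r where l: "l \<in> I" and r: "strict_mono (r :: nat \<Rightarrow> nat)" "(s0 \<circ> r) \<longlonglongrightarrow> l"
    using I(1) s0(1) unfolding compact_def by blast
  define s where "s = s0 \<circ> r"
  define u where "u = t \<circ> r"
  have s: "\<And>n. s n \<in> I" "s \<longlonglongrightarrow> l" and u: "\<And>n. u n > 0"
    using s0 r(2) t0(1) by (simp_all add: s_def u_def)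
  have lim: "(\<lambda>n. (f (s n) - f a) /\<^sub>R u n) \<longlonglongrightarrow> d"
    using LIMSEQ_subseq_LIMSEQ[OF lim0 r(1)] by (simp add: s_def u_def s0(2) o_def)
  have "u \<longlonglongrightarrow> 0"
    using LIMSEQ_subseq_LIMSEQ[OF t0(2) r(1)] by (simp add: u_def)
  then have "(\<lambda>n. f (s n)) \<longlonglongrightarrow> f a"
    using contingent_tendsto[OF u _ lim] by blast
  moreover have "(\<lambda>n. f (s n)) \<longlonglongrightarrow> f l"
    using continuous_on_tendsto_compose[OF I(2) s(2) l] s(1) by simp
  ultimately have "f l = f a" using LIMSEQ_unique by blast
  then have "l = a" using inj l by blast
  \<comment> \<open>As \<open>d\<close> is nonzero, the points eventually differ from
    \<open>f a\<close>; then the parameters differ from \<open>a\<close> and difference quotients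
    make sense.\<close>
  have ne: "\<forall>\<^sub>F n in sequentially. f (s n) - f a \<noteq> 0"
    using tendsto_imp_eventually_ne[OF lim False] by eventually_elim auto
  have "filterlim s (at a within I) sequentially"
    unfolding filterlim_at using s \<open>l = a\<close> ne by (auto elim: eventually_mono)
  with has_vector_derivative_quotient[OF der(1)]
  have quot: "(\<lambda>n. (f (s n) - f a) /\<^sub>R (s n - a)) \<longlonglongrightarrow> v"
    using filterlim_compose by blast
  \<comment> \<open>Eventually this is \<open>\<bar>s n - a\<bar> / u n\<close>, written as a
    quotient of norms of convergent sequences so that its limit is known.\<close>
  define m where "m n = norm ((f (s n) - f a) /\<^sub>R u n) / norm ((f (s n) - f a) /\<^sub>R (s n - a))" for n
  have "m \<longlonglongrightarrow> norm d / norm v"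
    unfolding m_def[abs_def] using lim quot der(2) by (intro tendsto_intros) auto
  then have "(\<lambda>n. m n *\<^sub>R (\<epsilon> *\<^sub>R ((f (s n) - f a) /\<^sub>R (s n - a)))) \<longlonglongrightarrow> (norm d / norm v) *\<^sub>R (\<epsilon> *\<^sub>R v)"
    using quot by (intro tendsto_intros)
  moreover have "\<forall>\<^sub>F n in sequentially.
      m n *\<^sub>R (\<epsilon> *\<^sub>R ((f (s n) - f a) /\<^sub>R (s n - a))) = (f (s n) - f a) /\<^sub>R u n"
    using ne
  proof eventually_elim
    case (elim n)
    then have sa: "s n - a \<noteq> 0" by auto
    have eps: "\<epsilon> * \<epsilon> = 1" using side(2) by (metis abs_mult_self_eq mult_1)
    have "\<bar>s n - a\<bar> = \<epsilon> * (s n - a)"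
      using side(1)[OF s(1)[of n]] side(2) by (metis abs_mult abs_of_nonneg mult_1)
    then have "m n = \<epsilon> * (s n - a) / u n"
      using elim u[of n] sa by (simp add: m_def divide_simps)
    then have "m n * \<epsilon> / (s n - a) = 1 / u n"
    proof -
      assume m: "m n = \<epsilon> * (s n - a) / u n"
      have "m n * \<epsilon> = (\<epsilon> * \<epsilon>) * (s n - a) / u n"
        unfolding m by (simp only: times_divide_eq_left times_divide_eq_right mult_ac)
      then show ?thesis using sa eps by simp
    qed
    then show ?case by (simp add: divide_inverse mult.assoc)
  qed
  ultimately have "(\<lambda>n. (f (s n) - f a) /\<^sub>R u n) \<longlonglongrightarrow> (norm d / norm v) *\<^sub>R (\<epsilon> *\<^sub>R v)"
    by (rule Lim_transform_eventually)
  then have "d = (norm d / norm v) *\<^sub>R (\<epsilon> *\<^sub>R v)"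
    using LIMSEQ_unique[OF lim] by blast
  then show ?thesis by (intro exI[of _ "norm d / norm v"]) auto
qed

section \<open>One-sided velocities and the two arms of a closed curve\<close>

lemma piecewise_smooth_curve_piece:
  assumes T: "finite T" "{0, 1} \<subseteq> T" "T \<subseteq> {0..1::real}"
    and pieces: "\<And>a b. a \<in> T \<Longrightarrow> b \<in> T \<Longrightarrow> a < b \<and> {a<..<b} \<inter> T = {} \<Longrightarrow>
         \<exists>V g. open V \<and> {a..b} \<subseteq> V \<and> smooth_on V g \<and>
            (\<forall>t\<in>{a..b}. c t = g t \<and> vector_derivative g (at t) \<noteq> 0)"
    and ab: "a \<in> T" "b \<in> T" "a < b" "{a<..<b} \<inter> T = {}" and s: "s \<in> {a..b}"
  shows "\<exists>v. v \<noteq> 0 \<and> (c has_vector_derivative v) (at s within {a..b})"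
proof -
  obtain V g where V: "open V" "{a..b} \<subseteq> V" "smooth_on V g"
    and g: "\<And>t. t \<in> {a..b} \<Longrightarrow> c t = g t \<and> vector_derivative g (at t) \<noteq> 0"
    using pieces[OF ab(1,2)] ab(3,4) by blast
  have "g differentiable (at s)"
    using smooth_on_has_derivative[OF V(3)] V(2) s differentiable_def by blast
  then have "(g has_vector_derivative vector_derivative g (at s)) (at s within {a..b})"
    using vector_derivative_works has_vector_derivative_at_within by blast
  then have "(c has_vector_derivative vector_derivative g (at s)) (at s within {a..b})"
    using has_vector_derivative_transform[OF s] g by metis
  then show ?thesis using g[OF s] by blast
qed

text \<open>\<open>b < 1\<close> keeps the arc away from the parameter 1, where a closed curve
  returns to its start.\<close>

lemma piecewise_smooth_curve_right:
  assumes "piecewise_smooth_curve c" "0 \<le> s" "s < 1"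
  shows "\<exists>v b. v \<noteq> 0 \<and> s < b \<and> b < 1 \<and> (c has_vector_derivative v) (at s within {s..b})"
proof -
  obtain T where T: "finite T" "{0, 1} \<subseteq> T" "T \<subseteq> {0..1}"
    and pieces: "\<And>a b. a \<in> T \<Longrightarrow> b \<in> T \<Longrightarrow> a < b \<and> {a<..<b} \<inter> T = {} \<Longrightarrow>
         \<exists>V g. open V \<and> {a..b} \<subseteq> V \<and> smooth_on V g \<and>
            (\<forall>t\<in>{a..b}. c t = g t \<and> vector_derivative g (at t) \<noteq> 0)"
    using assms(1) unfolding piecewise_smooth_curve_def by metis
  \<comment> \<open>\<open>Max A\<close> and \<open>Min B\<close> are the neighbouring partition
    points on either side of \<open>s\<close>.\<close>
  define A where "A = {x \<in> T. x \<le> s}"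
  define B where "B = {x \<in> T. s < x}"
  have AB: "finite A" "A \<noteq> {}" "finite B" "B \<noteq> {}"
    using T assms(2,3) by (auto simp: A_def B_def)
  then have "Max A \<in> A" "Min B \<in> B" by simp_all
  moreover have "{Max A<..<Min B} \<inter> T = {}"
  proof -
    have "T \<subseteq> A \<union> B" by (auto simp: A_def B_def)
    moreover have "x \<le> Max A" if "x \<in> A" for x using Max_ge[OF AB(1) that] .
    moreover have "Min B \<le> x" if "x \<in> B" for x using Min_le[OF AB(3) that] .
    ultimately have "\<not> (Max A < x \<and> x < Min B)" if "x \<in> T" for x
      using that by (metis UnE not_le subsetD)
    then show ?thesis by auto
  qed
  ultimately have m: "Max A \<in> T" "Min B \<in> T" "Max A \<le> s" "s < Min B" "{Max A<..<Min B} \<inter> T = {}"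
    by (auto simp: A_def B_def)
  have s: "Max A < Min B" "s \<in> {Max A..Min B}" using m(3,4) by auto
  obtain v where v: "v \<noteq> 0" "(c has_vector_derivative v) (at s within {Max A..Min B})"
    using piecewise_smooth_curve_piece[OF T pieces m(1,2) s(1) m(5) s(2)] by blast
  define b where "b = (s + Min B) / 2"
  have "Min B \<le> 1" using m(2) T(3) by auto
  then have "s < b" "b < 1" "{s..b} \<subseteq> {Max A..Min B}"
    using m(3,4) by (auto simp: b_def)
  then show ?thesis using v has_vector_derivative_within_subset by blast
qed

lemma piecewise_smooth_curve_left:
  assumes "piecewise_smooth_curve c" "0 < s" "s \<le> 1"
  shows "\<exists>v a. v \<noteq> 0 \<and> 0 < a \<and> a < s \<and> (c has_vector_derivative v) (at s within {a..s})"
proof -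
  obtain T where T: "finite T" "{0, 1} \<subseteq> T" "T \<subseteq> {0..1}"
    and pieces: "\<And>a b. a \<in> T \<Longrightarrow> b \<in> T \<Longrightarrow> a < b \<and> {a<..<b} \<inter> T = {} \<Longrightarrow>
         \<exists>V g. open V \<and> {a..b} \<subseteq> V \<and> smooth_on V g \<and>
            (\<forall>t\<in>{a..b}. c t = g t \<and> vector_derivative g (at t) \<noteq> 0)"
    using assms(1) unfolding piecewise_smooth_curve_def by metis
  define A where "A = {x \<in> T. x < s}"
  define B where "B = {x \<in> T. s \<le> x}"
  have AB: "finite A" "A \<noteq> {}" "finite B" "B \<noteq> {}"
    using T assms(2,3) by (auto simp: A_def B_def)
  then have "Max A \<in> A" "Min B \<in> B" by simp_all
  moreover have "{Max A<..<Min B} \<inter> T = {}"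
  proof -
    have "T \<subseteq> A \<union> B" by (auto simp: A_def B_def)
    moreover have "x \<le> Max A" if "x \<in> A" for x using Max_ge[OF AB(1) that] .
    moreover have "Min B \<le> x" if "x \<in> B" for x using Min_le[OF AB(3) that] .
    ultimately have "\<not> (Max A < x \<and> x < Min B)" if "x \<in> T" for x
      using that by (metis UnE not_le subsetD)
    then show ?thesis by auto
  qed
  ultimately have m: "Max A \<in> T" "Min B \<in> T" "Max A < s" "s \<le> Min B" "{Max A<..<Min B} \<inter> T = {}"
    by (auto simp: A_def B_def)
  have s: "Max A < Min B" "s \<in> {Max A..Min B}" using m(3,4) by auto
  obtain v where v: "v \<noteq> 0" "(c has_vector_derivative v) (at s within {Max A..Min B})"
    using piecewise_smooth_curve_piece[OF T pieces m(1,2) s(1) m(5) s(2)] by blast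
  define a where "a = (s + Max A) / 2"
  have "0 \<le> Max A" using m(1) T(3) by auto
  then have "0 < a" "a < s" "{a..s} \<subseteq> {Max A..Min B}"
    using m(3,4) assms(2) by (auto simp: a_def)
  then show ?thesis using v has_vector_derivative_within_subset by blast
qed

text \<open>Near \<open>p\<close> the curve consists of an outgoing and an incoming arc with
  one-sided velocities; the rest is compact and misses \<open>p\<close>. At the base point the two
  arcs sit at the two ends of the parameter interval, hence the case distinction.\<close>

lemma closed_curve_contingent:
  assumes \<gamma>: "simple_path \<gamma>" "pathfinish \<gamma> = pathstart \<gamma>" "piecewise_smooth_curve \<gamma>"
    and p: "p \<in> path_image \<gamma>"
  shows "\<exists>a b. \<forall>d. contingent (path_image \<gamma>) p d \<longrightarrow> (\<exists>r\<ge>0. d = r *\<^sub>R a \<or> d = r *\<^sub>R b)"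
proof -
  have cont: "continuous_on {0..1} \<gamma>"
    using \<gamma>(1) by (simp add: simple_path_def path_def)
  have cont_sub: "continuous_on I \<gamma>" if "I \<subseteq> {0..1}" for I
    using cont that by (rule continuous_on_subset)
  have inj: "x = y \<or> x = 0 \<and> y = 1 \<or> x = 1 \<and> y = 0" if "x \<in> {0..1}" "y \<in> {0..1}" "\<gamma> x = \<gamma> y" for x y
    using \<gamma>(1) that by (auto simp: simple_path_def loop_free_def)
  have ends: "\<gamma> 0 = \<gamma> 1" using \<gamma>(2) by (simp add: pathfinish_def pathstart_def)
  have closed_arc: "closed (\<gamma> ` {x..y})" if "{x..y} \<subseteq> {0..1}" for x y
    by (intro compact_imp_closed compact_continuous_image cont_sub that compact_Icc)
  have right: "\<exists>r\<ge>0. d = r *\<^sub>R v"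
    if "(\<gamma> has_vector_derivative v) (at s within {s..b})" "v \<noteq> 0" "0 \<le> s" "s < b" "b < 1"
      "contingent (\<gamma> ` {s..b}) (\<gamma> s) d" for v s b d
  proof -
    have sub: "{s..b} \<subseteq> {0..1}" using that(3-5) by auto
    have "x = s" if "x \<in> {s..b}" "\<gamma> x = \<gamma> s" for x
      using inj[of x s] that \<open>0 \<le> s\<close> \<open>s < b\<close> \<open>b < 1\<close> by auto
    then have "\<exists>r\<ge>0. d = r *\<^sub>R (1 *\<^sub>R v)"
      by (rule contingent_arc[OF that(1,2) compact_Icc cont_sub[OF sub] _ _ _ that(6)]) auto
    then show ?thesis by simp
  qed
  have left: "\<exists>r\<ge>0. d = r *\<^sub>R (- v)"
    if "(\<gamma> has_vector_derivative v) (at s within {a..s})" "v \<noteq> 0" "0 < a" "a < s" "s \<le> 1"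
      "contingent (\<gamma> ` {a..s}) (\<gamma> s) d" for v s a d
  proof -
    have sub: "{a..s} \<subseteq> {0..1}" using that(3-5) by auto
    have "x = s" if "x \<in> {a..s}" "\<gamma> x = \<gamma> s" for x
      using inj[of x s] that \<open>0 < a\<close> \<open>a < s\<close> \<open>s \<le> 1\<close> by auto
    then have "\<exists>r\<ge>0. d = r *\<^sub>R ((- 1) *\<^sub>R v)"
      by (rule contingent_arc[OF that(1,2) compact_Icc cont_sub[OF sub] _ _ _ that(6)]) auto
    then show ?thesis by simp
  qed
  obtain s where s: "s \<in> {0..1}" "p = \<gamma> s" using p by (auto simp: path_image_def)
  show ?thesis
  proof (cases "s \<in> {0<..<1}")
    case True
    obtain v b where v: "v \<noteq> 0" "s < b" "b < 1" "(\<gamma> has_vector_derivative v) (at s within {s..b})"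
      using piecewise_smooth_curve_right[OF \<gamma>(3), of s] True by auto
    obtain w a where w: "w \<noteq> 0" "0 < a" "a < s" "(\<gamma> has_vector_derivative w) (at s within {a..s})"
      using piecewise_smooth_curve_left[OF \<gamma>(3), of s] True by auto
    have "{0..1} = ({a..s} \<union> {s..b}) \<union> ({0..a} \<union> {b..1})"
      using v(2,3) w(2,3) by auto
    then have img: "path_image \<gamma> = (\<gamma> ` {a..s} \<union> \<gamma> ` {s..b}) \<union> (\<gamma> ` {0..a} \<union> \<gamma> ` {b..1})"
      unfolding path_image_def by (metis image_Un)
    have far: "closed (\<gamma> ` {0..a} \<union> \<gamma> ` {b..1})" "p \<notin> \<gamma> ` {0..a} \<union> \<gamma> ` {b..1}"
    proof -
      show "closed (\<gamma> ` {0..a} \<union> \<gamma> ` {b..1})"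
        using v(2,3) w(2,3) True by (intro closed_Un closed_arc) auto
      have "\<gamma> x \<noteq> \<gamma> s" if "x \<in> {0..a} \<union> {b..1}" for x
        using inj[of x s] that v(2,3) w(2,3) True by auto
      then show "p \<notin> \<gamma> ` {0..a} \<union> \<gamma> ` {b..1}"
        unfolding s(2) by (metis (no_types, lifting) Un_iff imageE)
    qed
    have "\<exists>r\<ge>0. d = r *\<^sub>R v \<or> d = r *\<^sub>R (- w)" if "contingent (path_image \<gamma>) p d" for d
    proof -
      have "contingent (\<gamma> ` {a..s}) p d \<or> contingent (\<gamma> ` {s..b}) p d"
        using contingent_Un[OF contingent_Un_far[OF that[unfolded img] far]] .
      then show ?thesis
      proof
        assume "contingent (\<gamma> ` {a..s}) p d"
        then show ?thesis
          using left[OF w(4,1,2,3)] True unfolding s(2) by (auto simp del: scaleR_minus_right)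
      next
        assume "contingent (\<gamma> ` {s..b}) p d"
        then show ?thesis
          using right[OF v(4,1) _ v(2,3)] True unfolding s(2) by (auto simp del: scaleR_minus_right)
      qed
    qed
    then show ?thesis by blast
  next
    case False
    then have p0: "p = \<gamma> 0" "p = \<gamma> 1" using s ends by force+
    obtain v b where v: "v \<noteq> 0" "0 < b" "b < 1" "(\<gamma> has_vector_derivative v) (at 0 within {0..b})"
      using piecewise_smooth_curve_right[OF \<gamma>(3), of 0] by auto
    obtain w a where w: "w \<noteq> 0" "0 < a" "a < 1" "(\<gamma> has_vector_derivative w) (at 1 within {a..1})"
      using piecewise_smooth_curve_left[OF \<gamma>(3), of 1] by auto
    \<comment> \<open>For \<open>a < b\<close> the middle interval is empty and the outer ones
      overlap, so the union is right in either case.\<close>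
    have "{0..1} = ({a..1} \<union> {0..b}) \<union> {b..a}"
      using v(2,3) w(2,3) by auto
    then have img: "path_image \<gamma> = (\<gamma> ` {a..1} \<union> \<gamma> ` {0..b}) \<union> \<gamma> ` {b..a}"
      unfolding path_image_def by (metis image_Un)
    have far: "closed (\<gamma> ` {b..a})" "p \<notin> \<gamma> ` {b..a}"
    proof -
      show "closed (\<gamma> ` {b..a})"
        using v(2,3) w(2,3) by (intro closed_arc) auto
      have "\<gamma> x \<noteq> \<gamma> 0" if "x \<in> {b..a}" for x
        using inj[of x 0] that v(2,3) w(2,3) by auto
      then show "p \<notin> \<gamma> ` {b..a}"
        unfolding p0(1) by (metis (no_types, lifting) imageE)
    qed
    have "\<exists>r\<ge>0. d = r *\<^sub>R v \<or> d = r *\<^sub>R (- w)" if "contingent (path_image \<gamma>) p d" for d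
    proof -
      have "contingent (\<gamma> ` {a..1}) p d \<or> contingent (\<gamma> ` {0..b}) p d"
        using contingent_Un[OF contingent_Un_far[OF that[unfolded img] far]] .
      then show ?thesis
      proof
        assume "contingent (\<gamma> ` {a..1}) p d"
        then show ?thesis
          using left[OF w(4,1,2,3)] unfolding p0(2) by (auto simp del: scaleR_minus_right)
      next
        assume "contingent (\<gamma> ` {0..b}) p d"
        then show ?thesis
          using right[OF v(4,1) _ v(2,3)] unfolding p0(1) by (auto simp del: scaleR_minus_right)
      qed
    qed
    then show ?thesis by blast
  qed
qed

lemma link_contingent:
  assumes \<Gamma>: "link_parametrization \<Gamma> L" and p: "p \<in> L"
  shows "\<exists>a b. \<forall>d. contingent L p d \<longrightarrow> (\<exists>r\<ge>0. d = r *\<^sub>R a \<or> d = r *\<^sub>R b)"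
proof -
  have L: "L = (\<Union>\<gamma>\<in>\<Gamma>. path_image \<gamma>)" and fin: "finite \<Gamma>"
    and disj: "pairwise (\<lambda>\<gamma> \<delta>. path_image \<gamma> \<inter> path_image \<delta> = {}) \<Gamma>"
    using \<Gamma> unfolding link_parametrization_def by blast+
  obtain \<gamma> where \<gamma>: "\<gamma> \<in> \<Gamma>" "p \<in> path_image \<gamma>" using p L by blast
  have comp: "simple_path \<delta> \<and> pathfinish \<delta> = pathstart \<delta> \<and> piecewise_smooth_curve \<delta>" if "\<delta> \<in> \<Gamma>" for \<delta>
    using that \<Gamma> unfolding link_parametrization_def by blast
  define M where "M = (\<Union>\<delta>\<in>\<Gamma> - {\<gamma>}. path_image \<delta>)"
  have "closed M"
    unfolding M_def using fin comp by (intro closed_UN) (auto intro: closed_path_image simple_path_imp_path)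
  moreover have "p \<notin> M"
    using disj \<gamma> unfolding M_def pairwise_def by blast
  moreover have "L = path_image \<gamma> \<union> M"
    using \<gamma>(1) by (auto simp: L M_def)
  ultimately have "contingent (path_image \<gamma>) p d" if "contingent L p d" for d
    using contingent_Un_far that by blast
  moreover obtain a b where "\<And>d. contingent (path_image \<gamma>) p d \<Longrightarrow> \<exists>r\<ge>0. d = r *\<^sub>R a \<or> d = r *\<^sub>R b"
    using closed_curve_contingent[of \<gamma> p] comp[OF \<gamma>(1)] \<gamma>(2) by metis
  ultimately show ?thesis by blast
qed

lemma tangent_vector_contingent:
  assumes "tangent_vector L p v" "\<bar>\<epsilon>\<bar> = 1"
  shows "contingent L p (\<epsilon> *\<^sub>R v)"
proof -
  obtain g e where e: "e > 0" and g: "g ` {-e<..<e} \<subseteq> L" "g 0 = p" "(g has_vector_derivative v) (at 0)"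
    using assms(1) unfolding tangent_vector_def by blast
  \<comment> \<open>The offset 2 makes even \<open>t 0\<close> smaller than
    \<open>e\<close>.\<close>
  define t where "t n = e / real (n + 2)" for n
  have t: "t n > 0" "t n < e" for n
    using e by (simp_all add: t_def divide_less_eq)
  have "t \<longlonglongrightarrow> 0"
    unfolding t_def using LIMSEQ_ignore_initial_segment[OF lim_const_over_n[of e], of 2] .
  then have "(\<lambda>n. \<epsilon> * t n) \<longlonglongrightarrow> 0"
    using tendsto_mult_right_zero by blast
  moreover have "\<epsilon> * t n \<noteq> 0" for n
    using t(1)[of n] assms(2) by auto
  ultimately have "filterlim (\<lambda>n. \<epsilon> * t n) (at 0) sequentially"
    by (simp add: filterlim_at)
  from filterlim_compose[OF has_vector_derivative_quotient[OF g(3)] this]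
  have lim: "(\<lambda>n. \<epsilon> *\<^sub>R ((g (\<epsilon> * t n) - p) /\<^sub>R (\<epsilon> * t n))) \<longlonglongrightarrow> \<epsilon> *\<^sub>R v"
    using g(2) by (intro tendsto_intros) simp
  have eq: "\<epsilon> *\<^sub>R ((g (\<epsilon> * t n) - p) /\<^sub>R (\<epsilon> * t n)) = (g (\<epsilon> * t n) - p) /\<^sub>R t n" for n
    using assms(2) by auto
  have "g (\<epsilon> * t n) \<in> L" for n
    using g(1) t[of n] assms(2) by (intro subsetD[OF g(1)] imageI) (auto simp: abs_if split: if_splits)
  then show ?thesis
    using t(1) \<open>t \<longlonglongrightarrow> 0\<close> lim[unfolded eq] unfolding contingent_def
    by (intro exI[of _ "\<lambda>n. g (\<epsilon> * t n)"] exI[of _ t]) simp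
qed

text \<open>The cone contains \<open>v\<close> and \<open>- v\<close>, but at most two rays, given by the one-sided velocities.\<close>

lemma contingent_tangent_line:
  assumes \<Gamma>: "link_parametrization \<Gamma> L" and v: "tangent_vector L p v" and d: "contingent L p d"
  shows "\<exists>r. d = r *\<^sub>R v"
proof -
  have "p \<in> L" using v unfolding tangent_vector_def by force
  then obtain a b where ab: "\<And>d. contingent L p d \<Longrightarrow> \<exists>r\<ge>0. d = r *\<^sub>R a \<or> d = r *\<^sub>R b"
    using link_contingent[OF \<Gamma>] by metis
  have v0: "v \<noteq> 0" using v by (simp add: tangent_vector_def)
  have pm: "contingent L p v" "contingent L p (- v)"
    using tangent_vector_contingent[OF v, of 1] tangent_vector_contingent[OF v, of "-1"] by simp_all
  obtain r s where r: "r \<ge> 0" "v = r *\<^sub>R a \<or> v = r *\<^sub>R b" and s: "s \<ge> 0" "- v = s *\<^sub>R a \<or> - v = s *\<^sub>R b"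
    using ab[OF pm(1)] ab[OF pm(2)] by blast
  \<comment> \<open>Opposite nonzero vectors cannot share a ray, so \<open>v\<close> and
    \<open>- v\<close> use up both rays, and \<open>a\<close> and \<open>b\<close> lie on the line
    of \<open>v\<close>.\<close>
  have opp: "\<not> (v = r *\<^sub>R c \<and> - v = s *\<^sub>R c)" for c
  proof
    assume c: "v = r *\<^sub>R c \<and> - v = s *\<^sub>R c"
    then have "(r + s) *\<^sub>R c = 0" by (simp add: scaleR_add_left) (metis add.right_inverse)
    then have "r = 0 \<or> c = 0" using r(1) s(1) by auto
    then show False using c v0 by auto
  qed
  have nz: "r \<noteq> 0" "s \<noteq> 0" using r(2) s(2) v0 by auto
  have "(v = r *\<^sub>R a \<and> - v = s *\<^sub>R b) \<or> (v = r *\<^sub>R b \<and> - v = s *\<^sub>R a)"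
    using r(2) s(2) opp by blast
  moreover have "\<exists>x. c = x *\<^sub>R v" if "v = r *\<^sub>R c \<or> - v = s *\<^sub>R c" for c
    using that
  proof
    assume "v = r *\<^sub>R c"
    then have "c = inverse r *\<^sub>R v" using nz by simp
    then show ?thesis by blast
  next
    assume "- v = s *\<^sub>R c"
    then have "c = inverse s *\<^sub>R (- v)" using nz by simp
    then have "c = (- inverse s) *\<^sub>R v" by simp
    then show ?thesis by blast
  qed
  ultimately have "\<exists>x. a = x *\<^sub>R v" "\<exists>x. b = x *\<^sub>R v" by blast+
  then show ?thesis using ab[OF d] by (metis scaleR_scaleR)
qed

text \<open>A sequence below is lifted to the link and has a subsequence converging to a point
  \<open>p\<close> over \<open>c\<close>, with normalised secants converging to a unit vector
  \<open>e\<close> on the line of \<open>V p\<close>. As this line is not vertical,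
  \<open>proj e\<close> is nonzero; so secant lengths above and below are comparable, and
  \<open>d\<close> is a multiple of \<open>proj e\<close>.\<close>

lemma contingent_proj:
  assumes L: "compact L"
    and line: "\<And>p e. p \<in> L \<Longrightarrow> proj p = c \<Longrightarrow> contingent L p e \<Longrightarrow> \<exists>r. e = r *\<^sub>R V p"
    and V: "\<And>p. p \<in> L \<Longrightarrow> proj p = c \<Longrightarrow> proj (V p) \<noteq> 0"
    and d: "contingent (proj ` L) c d" "d \<noteq> 0"
  shows "\<exists>p\<in>L. proj p = c \<and> (\<exists>r. d = r *\<^sub>R proj (V p))"
proof -
  obtain y t where "\<And>n. y n \<in> proj ` L" and t0: "\<And>n. t n > 0" "t \<longlonglongrightarrow> 0"
    and lim0: "(\<lambda>n. (y n - c) /\<^sub>R t n) \<longlonglongrightarrow> d"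
    using d(1) unfolding contingent_def by blast
  then have "\<forall>n. \<exists>x\<in>L. y n = proj x" by blast
  then obtain x0 where x0: "\<And>n. x0 n \<in> L" "\<And>n. y n = proj (x0 n)" by metis
  obtain p r where p: "p \<in> L" and r: "strict_mono (r :: nat \<Rightarrow> nat)" "(x0 \<circ> r) \<longlonglongrightarrow> p"
    using L x0(1) unfolding compact_def by blast
  define x1 where "x1 = x0 \<circ> r"
  define t1 where "t1 = t \<circ> r"
  have lim1: "(\<lambda>n. (proj (x1 n) - c) /\<^sub>R t1 n) \<longlonglongrightarrow> d"
    using LIMSEQ_subseq_LIMSEQ[OF lim0 r(1)] by (simp add: x1_def t1_def x0(2) o_def)
  have t1: "\<And>n. t1 n > 0" "t1 \<longlonglongrightarrow> 0"
    using t0 LIMSEQ_subseq_LIMSEQ[OF t0(2) r(1)] by (simp_all add: t1_def)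
  have "(\<lambda>n. proj (x1 n)) \<longlonglongrightarrow> c"
    using contingent_tendsto[OF t1 lim1] .
  moreover have "(\<lambda>n. proj (x1 n)) \<longlonglongrightarrow> proj p"
    using bounded_linear.tendsto[OF bounded_linear_proj r(2)] by (simp add: x1_def)
  ultimately have pc: "proj p = c" using LIMSEQ_unique by blast
  have "\<forall>\<^sub>F n in sequentially. x1 n \<noteq> p"
    using tendsto_imp_eventually_ne[OF lim1 d(2)] by eventually_elim (use pc in auto)
  then obtain N where N: "\<And>n. n \<ge> N \<Longrightarrow> x1 n \<noteq> p"
    unfolding eventually_sequentially by blast
  define x2 where "x2 n = x1 (n + N)" for n
  define t2 where "t2 n = t1 (n + N)" for n
  have x2: "\<And>n. x2 n \<in> L" "\<And>n. x2 n \<noteq> p" "x2 \<longlonglongrightarrow> p"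
    using x0(1) N LIMSEQ_ignore_initial_segment[OF r(2), of N] by (simp_all add: x2_def[abs_def] x1_def)
  have "(\<lambda>n. sgn (x2 n - p)) n \<in> sphere 0 1" for n
    using x2(2)[of n] by (simp add: norm_sgn)
  then obtain e q where e: "e \<in> sphere 0 1" and q: "strict_mono (q :: nat \<Rightarrow> nat)"
    "((\<lambda>n. sgn (x2 n - p)) \<circ> q) \<longlonglongrightarrow> e"
    using compact_sphere[of "0 :: real^3" 1] unfolding compact_def by metis
  define x where "x = x2 \<circ> q"
  define t where "t = t2 \<circ> q"
  have lim: "(\<lambda>n. (proj (x n) - c) /\<^sub>R t n) \<longlonglongrightarrow> d"
    using LIMSEQ_subseq_LIMSEQ[OF LIMSEQ_ignore_initial_segment[OF lim1, of N] q(1)]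
    by (simp add: x_def t_def x2_def t2_def o_def)
  have tpos: "t n > 0" for n using t1(1) by (simp add: t_def t2_def)
  have x: "\<And>n. x n \<in> L" "\<And>n. x n \<noteq> p" "x \<longlonglongrightarrow> p"
    using x2 LIMSEQ_subseq_LIMSEQ[OF x2(3) q(1)] by (simp_all add: x_def)
  have dir: "(\<lambda>n. (x n - p) /\<^sub>R norm (x n - p)) \<longlonglongrightarrow> e"
    using q(2) by (simp add: x_def o_def sgn_div_norm)
  have "(\<lambda>n. norm (x n - p)) \<longlonglongrightarrow> 0"
    using x(3) by (simp add: LIM_zero tendsto_norm_zero)
  then have "contingent L p e"
    using x dir by (intro contingentI[of x L "\<lambda>n. norm (x n - p)"]) auto
  then obtain \<rho> where \<rho>: "e = \<rho> *\<^sub>R V p"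
    using line[OF p pc] by blast
  have pe: "proj e = \<rho> *\<^sub>R proj (V p)"
    unfolding \<rho> by (rule linear_scale[OF bounded_linear.linear[OF bounded_linear_proj]])
  have "\<rho> \<noteq> 0" using e \<rho> by auto
  then have pe0: "proj e \<noteq> 0" using pe V[OF p pc] by simp
  have dirp: "(\<lambda>n. (proj (x n) - c) /\<^sub>R norm (x n - p)) \<longlonglongrightarrow> proj e"
  proof -
    have "proj ((x n - p) /\<^sub>R norm (x n - p)) = (proj (x n) - c) /\<^sub>R norm (x n - p)" for n
      using bounded_linear.linear[OF bounded_linear_proj] pc by (simp add: linear_scale linear_diff)
    then show ?thesis
      using bounded_linear.tendsto[OF bounded_linear_proj dir] by simp
  qed
  \<comment> \<open>As for arcs, the ratio of the two scalings is expressed by norms of convergent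
    sequences.\<close>
  define m where "m n = norm ((proj (x n) - c) /\<^sub>R t n) / norm ((proj (x n) - c) /\<^sub>R norm (x n - p))" for n
  have "m \<longlonglongrightarrow> norm d / norm (proj e)"
    unfolding m_def[abs_def] using lim dirp pe0 by (intro tendsto_intros) auto
  then have "(\<lambda>n. m n *\<^sub>R ((proj (x n) - c) /\<^sub>R norm (x n - p))) \<longlonglongrightarrow> (norm d / norm (proj e)) *\<^sub>R proj e"
    using dirp by (intro tendsto_intros)
  moreover have "\<forall>\<^sub>F n in sequentially.
      m n *\<^sub>R ((proj (x n) - c) /\<^sub>R norm (x n - p)) = (proj (x n) - c) /\<^sub>R t n"
    using tendsto_imp_eventually_ne[OF lim d(2)]
  proof eventually_elim
    case (elim n)
    then have "m n = norm (x n - p) / t n"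
      using tpos[of n] x(2)[of n] by (auto simp: m_def divide_simps)
    then show ?case using x(2)[of n] by (simp add: divide_inverse)
  qed
  ultimately have "(\<lambda>n. (proj (x n) - c) /\<^sub>R t n) \<longlonglongrightarrow> (norm d / norm (proj e)) *\<^sub>R proj e"
    by (rule Lim_transform_eventually)
  then have "d = (norm d / norm (proj e)) *\<^sub>R proj e"
    using LIMSEQ_unique[OF lim] by blast
  then have "d = (norm d / norm (proj e) * \<rho>) *\<^sub>R proj (V p)"
    unfolding pe by simp
  then show ?thesis using p pc by blast
qed

text \<open>If \<open>h t\<close> were outside \<open>R\<close> for arbitrarily small
  \<open>t\<close>, the segments from \<open>k t\<close> to \<open>h t\<close> would meet
  \<open>U\<close>. The points where they do are convex combinations and thus have the same limiting
  direction \<open>d\<close>, which would be contingent to \<open>U\<close>.\<close>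

lemma region_of_tangent_curves:
  fixes U :: "'a::real_normed_vector set"
  assumes R: "R \<in> components (- U)"
    and k: "((\<lambda>t. (k t - c) /\<^sub>R t) \<longlongrightarrow> d) (at_right 0)"
    and h: "((\<lambda>t. (h t - c) /\<^sub>R t) \<longlongrightarrow> d) (at_right 0)"
    and d: "\<not> contingent U c d"
    and kR: "\<forall>\<^sub>F t in at_right 0. k t \<in> R"
  shows "\<forall>\<^sub>F t in at_right 0. h t \<in> R"
proof (rule ccontr)
  assume "\<not> (\<forall>\<^sub>F t in at_right 0. h t \<in> R)"
  then have nf: "\<exists>\<^sub>F t in at_right 0. h t \<notin> R"
    by (simp add: frequently_def)
  have freq: "\<exists>\<^sub>F t in at_right 0. k t \<in> R \<and> h t \<notin> R"
    by (rule frequently_elim1[OF frequently_eventually_frequently[OF nf kR]]) simp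
  have seg: "\<exists>u\<in>{0..1}. k t + u *\<^sub>R (h t - k t) \<in> U" if "k t \<in> R" "h t \<notin> R" for t
  proof (rule ccontr)
    assume "\<not> ?thesis"
    then have no: "k t + u *\<^sub>R (h t - k t) \<notin> U" if "u \<in> {0..1}" for u
      using that by blast
    have "closed_segment (k t) (h t) \<subseteq> - U"
    proof
      fix x assume "x \<in> closed_segment (k t) (h t)"
      then obtain u where "u \<in> {0..1}" "x = (1 - u) *\<^sub>R k t + u *\<^sub>R h t"
        unfolding closed_segment_def by auto
      moreover from this have "x = k t + u *\<^sub>R (h t - k t)"
        by (simp add: algebra_simps)
      ultimately show "x \<in> - U" using no by (metis ComplI)
    qed
    moreover have "R \<inter> closed_segment (k t) (h t) \<noteq> {}" using that(1) by auto
    ultimately have "closed_segment (k t) (h t) \<subseteq> R"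
      using components_maximal[OF R connected_segment(1)] by blast
    then show False using that(2) by auto
  qed
  have "\<exists>t u. 0 < t \<and> t < inverse (Suc n) \<and> u \<in> {0..1} \<and> k t + u *\<^sub>R (h t - k t) \<in> U" for n
  proof -
    obtain t where "t > 0" "dist t 0 < inverse (Suc n)" "k t \<in> R" "h t \<notin> R"
      using freq unfolding frequently_at by (metis greaterThan_iff inverse_positive_iff_positive of_nat_0_less_iff zero_less_Suc)
    moreover from this obtain u where "u \<in> {0..1}" "k t + u *\<^sub>R (h t - k t) \<in> U"
      using seg[of t] by blast
    moreover have "t < inverse (Suc n)"
      using calculation(1,2) by (simp add: dist_real_def)
    ultimately show ?thesis by blast
  qed
  then obtain t u where t: "\<And>n. 0 < t n" "\<And>n. t n < inverse (Suc n)" and u: "\<And>n. u n \<in> {0..1}"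
    and U: "\<And>n. k (t n) + u n *\<^sub>R (h (t n) - k (t n)) \<in> U"
    by metis
  have t0: "t \<longlonglongrightarrow> 0"
    by (rule tendsto_sandwich[OF _ _ tendsto_const LIMSEQ_inverse_real_of_nat])
      (use t in \<open>auto intro!: always_eventually less_imp_le\<close>)
  then have f: "filterlim t (at_right 0) sequentially"
    unfolding filterlim_at using t(1) by (auto simp: less_imp_neq[symmetric])
  have K: "(\<lambda>n. (k (t n) - c) /\<^sub>R t n) \<longlonglongrightarrow> d" and H: "(\<lambda>n. (h (t n) - c) /\<^sub>R t n) \<longlonglongrightarrow> d"
    using filterlim_compose[OF k f] filterlim_compose[OF h f] .
  have D: "(\<lambda>n. (h (t n) - c) /\<^sub>R t n - (k (t n) - c) /\<^sub>R t n) \<longlonglongrightarrow> 0"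
    using tendsto_diff[OF H K] by simp
  have "(\<lambda>n. u n *\<^sub>R ((h (t n) - c) /\<^sub>R t n - (k (t n) - c) /\<^sub>R t n)) \<longlonglongrightarrow> 0"
  proof (rule Lim_null_comparison[OF always_eventually tendsto_norm_zero[OF D]], intro allI)
    fix n
    show "norm (u n *\<^sub>R ((h (t n) - c) /\<^sub>R t n - (k (t n) - c) /\<^sub>R t n))
        \<le> norm ((h (t n) - c) /\<^sub>R t n - (k (t n) - c) /\<^sub>R t n)"
      using u[of n] by (simp add: mult_left_le_one_le)
  qed
  from tendsto_add[OF K this]
  have "(\<lambda>n. (k (t n) - c) /\<^sub>R t n + u n *\<^sub>R ((h (t n) - c) /\<^sub>R t n - (k (t n) - c) /\<^sub>R t n)) \<longlonglongrightarrow> d"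
    by simp
  moreover have "(k (t n) - c) /\<^sub>R t n + u n *\<^sub>R ((h (t n) - c) /\<^sub>R t n - (k (t n) - c) /\<^sub>R t n)
      = (k (t n) + u n *\<^sub>R (h (t n) - k (t n)) - c) /\<^sub>R t n" for n
    by (simp add: algebra_simps)
  ultimately have "contingent U c d"
    unfolding contingent_def using t(1) t0 U
    by (intro exI[of _ "\<lambda>n. k (t n) + u n *\<^sub>R (h (t n) - k (t n))"] exI[of _ t]) simp
  then show False using d by blast
qed

section \<open>Inverted diagrams and Goeritz matrices\<close>

lemma universe_projected_diagram [simp]: "universe (projected_diagram L) = proj ` L"
  by (simp add: projected_diagram_def)

lemma proj_lift_invert_image: "proj ` lift_invert P ` L = invert P ` proj ` L"
  by (simp add: image_image)

lemma lift_invert_image_twice [simp]: "lift_invert P ` lift_invert P ` L = L"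
  by (simp add: image_image)

lemma invert_image_twice [simp]: "invert P ` invert P ` S = S"
  by (simp add: image_image)

lemma center_not_in_lift_invert: "P \<notin> proj ` L \<Longrightarrow> P \<notin> proj ` lift_invert P ` L"
  by (auto simp: image_image)

lemma compact_proj: "compact L \<Longrightarrow> compact (proj ` L)"
  by (intro compact_continuous_image linear_continuous_on bounded_linear_proj)

lemma compact_lift_invert:
  assumes "compact L" "P \<notin> proj ` L"
  shows "compact (lift_invert P ` L)"
proof -
  have "L \<subseteq> {p. proj p \<noteq> P}" using assms(2) by auto
  then have "continuous_on L (lift_invert P)"
    by (rule continuous_on_subset[OF smooth_on_imp_continuous_on[OF smooth_on_lift_invert]])
  then show ?thesis using assms(1) by (rule compact_continuous_image)
qed

lemma crossing_in_universe: "c \<in> crossings (projected_diagram L) \<Longrightarrow> c \<in> proj ` L"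
  by (auto simp: projected_diagram_def)

lemma invert_crossing:
  assumes "c \<in> crossings (projected_diagram L)"
  shows "invert P c \<in> crossings (projected_diagram (lift_invert P ` L))"
proof -
  obtain p q where "p \<in> L" "q \<in> L" "p \<noteq> q" "proj p = c" "proj q = c"
    using assms by (auto simp: projected_diagram_def)
  then have "lift_invert P p \<in> lift_invert P ` L" "lift_invert P q \<in> lift_invert P ` L"
    "lift_invert P p \<noteq> lift_invert P q" "proj (lift_invert P p) = invert P c"
    "proj (lift_invert P q) = invert P c"
    using injD[OF inj_lift_invert] by auto
  then show ?thesis
    by (simp only: projected_diagram_def link_diagram.simps mem_Collect_eq) blast
qed

lemma crossings_lift_invert:
  "crossings (projected_diagram (lift_invert P ` L)) = invert P ` crossings (projected_diagram L)"
  using invert_crossing[of _ L P] invert_crossing[of _ "lift_invert P ` L" P]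
  by (auto simp: invert_image_iff)

lemma flip_region:
  assumes "compact L" "P \<notin> proj ` L" "R \<in> regions (projected_diagram L)"
  shows "flip P R \<in> regions (projected_diagram (lift_invert P ` L))"
  using flip_component[OF compact_proj[OF assms(1)] assms(2)] assms(3)
  by (simp add: regions_def proj_lift_invert_image)

lemma flip_flip_region:
  assumes "compact L" "P \<notin> proj ` L" "R \<in> regions (projected_diagram L)"
  shows "flip P (flip P R) = R"
  using flip_flip[OF compact_imp_closed[OF compact_proj[OF assms(1)]] assms(2)] assms(3)
  by (simp add: regions_def)

lemma regions_lift_invert:
  assumes "compact L" "P \<notin> proj ` L"
  shows "regions (projected_diagram (lift_invert P ` L)) = flip P ` regions (projected_diagram L)"
proof -
  note swap = compact_lift_invert[OF assms] center_not_in_lift_invert[OF assms(2)]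
  have "R \<in> flip P ` regions (projected_diagram L)"
    if "R \<in> regions (projected_diagram (lift_invert P ` L))" for R
    using flip_region[OF swap that] flip_flip_region[OF swap that] by (metis image_eqI lift_invert_image_twice)
  then show ?thesis using flip_region[OF assms] by blast
qed

lemma inj_on_flip:
  assumes "compact L" "P \<notin> proj ` L"
  shows "inj_on (flip P) (regions (projected_diagram L))"
  by (rule inj_on_inverseI[of _ "flip P"]) (rule flip_flip_region[OF assms])

lemma unshaded_lift_invert:
  assumes "compact L" "P \<notin> proj ` L" "\<sigma> \<subseteq> regions (projected_diagram L)"
  shows "unshaded (projected_diagram (lift_invert P ` L)) (flip P ` \<sigma>)
    = flip P ` unshaded (projected_diagram L) \<sigma>"
  unfolding unshaded_def regions_lift_invert[OF assms(1,2)]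
  using inj_on_image_set_diff[OF inj_on_flip[OF assms(1,2)] Diff_subset assms(3)] by simp

lemma invert_edge:
  assumes "P \<notin> proj ` L" "e \<in> edges (projected_diagram L)"
  shows "invert P ` e \<in> edges (projected_diagram (lift_invert P ` L))"
proof -
  have "invert P ` e \<in> components (invert P ` (proj ` L - crossings (projected_diagram L)))"
    using assms by (intro invert_component) (auto simp: edges_def)
  then show ?thesis
    by (simp only: edges_def universe_projected_diagram crossings_lift_invert proj_lift_invert_image
        image_set_diff[OF inj_invert])
qed

lemma flip_shading:
  assumes L: "compact L" "P \<notin> proj ` L" and \<sigma>: "checkerboard_shading (projected_diagram L) \<sigma>"
  shows "checkerboard_shading (projected_diagram (lift_invert P ` L)) (flip P ` \<sigma>)"
proof -
  let ?D = "projected_diagram L" and ?D' = "projected_diagram (lift_invert P ` L)"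
  have sub: "\<sigma> \<subseteq> regions ?D" using \<sigma> by (simp add: checkerboard_shading_def)
  have uns: "regions ?D' - flip P ` \<sigma> = flip P ` (regions ?D - \<sigma>)"
    using unshaded_lift_invert[OF L sub] by (simp only: unshaded_def)
  have "\<exists>R\<in>flip P ` \<sigma>. \<exists>R'\<in>regions ?D' - flip P ` \<sigma>. e \<subseteq> frontier R \<and> e \<subseteq> frontier R'"
    if e: "e \<in> edges ?D'" for e
  proof -
    have ie: "invert P ` e \<in> edges ?D"
      using invert_edge[OF center_not_in_lift_invert[OF L(2)] e] by simp
    obtain R R' where R: "R \<in> \<sigma>" "R' \<in> regions ?D - \<sigma>" "invert P ` e \<subseteq> frontier R"
      "invert P ` e \<subseteq> frontier R'"
      using bspec[OF conjunct2[OF \<sigma>[unfolded checkerboard_shading_def]] ie] by (elim bexE conjE)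
    have "e \<subseteq> proj ` lift_invert P ` L"
      using in_components_subset[OF e[unfolded edges_def]] by auto
    then have Pe: "invert P x \<noteq> P" if "x \<in> e" for x
      using that center_not_in_lift_invert[OF L(2)] by auto
    have "e \<subseteq> frontier (flip P S)" if "S \<in> regions ?D" "invert P ` e \<subseteq> frontier S" for S
    proof
      fix x assume x: "x \<in> e"
      then have "invert P (invert P x) \<in> frontier (flip P S)"
        using that Pe[OF x] unfolding regions_def universe_projected_diagram
        by (intro frontier_flip[OF compact_proj[OF L(1)] L(2)]) auto
      then show "x \<in> frontier (flip P S)" by simp
    qed
    then have "e \<subseteq> frontier (flip P R)" "e \<subseteq> frontier (flip P R')"
      using R sub by blast+
    then show ?thesis
      unfolding uns using R(1,2) by blast
  qed
  moreover have "flip P ` \<sigma> \<subseteq> regions ?D'"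
    using sub unfolding regions_lift_invert[OF L] by blast
  ultimately show ?thesis unfolding checkerboard_shading_def by blast
qed

section \<open>Crossings and their Goeritz indices\<close>

lemma invert_common_crossing:
  assumes "P \<notin> proj ` L" "c \<in> common_crossings (projected_diagram L) R S"
  shows "invert P c \<in> common_crossings (projected_diagram (lift_invert P ` L)) (flip P R) (flip P S)"
proof -
  have "c \<noteq> P"
    using assms crossing_in_universe unfolding common_crossings_def by blast
  then show ?thesis
    using assms(2) unfolding common_crossings_def by (auto intro: invert_crossing closure_flip)
qed

lemma common_crossings_lift_invert:
  assumes L: "compact L" "P \<notin> proj ` L"
    and RS: "R \<in> regions (projected_diagram L)" "S \<in> regions (projected_diagram L)"
  shows "common_crossings (projected_diagram (lift_invert P ` L)) (flip P R) (flip P S)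
    = invert P ` common_crossings (projected_diagram L) R S"
  using invert_common_crossing[OF L(2), of _ R S]
    invert_common_crossing[OF center_not_in_lift_invert[OF L(2)], of _ "flip P R" "flip P S"]
  by (auto simp: invert_image_iff flip_flip_region[OF L RS(1)] flip_flip_region[OF L RS(2)])

text \<open>The observer's direction \<open>a + b\<close> is a diagonal of the corner. Lying off
  both tangent lines, it will turn out not to be contingent to the universe.\<close>

lemma sum_not_on_lines:
  assumes "Im (cnj b * a) \<noteq> 0"
  shows "a + b \<noteq> r *\<^sub>R a" "a + b \<noteq> r *\<^sub>R b"
proof -
  have im: "Im (cnj b * (a + b)) = Im (cnj b * a)" by (simp add: algebra_simps)
  show "a + b \<noteq> r *\<^sub>R b"
  proof
    assume eq: "a + b = r *\<^sub>R b"
    have "Im (cnj b * (a + b)) = 0"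
      unfolding eq by (simp add: algebra_simps)
    then show False using im assms by simp
  qed
  show "a + b \<noteq> r *\<^sub>R a"
  proof
    assume eq: "a + b = r *\<^sub>R a"
    then have "Im (cnj b * a) = r * Im (cnj b * a)"
      using im by (simp add: algebra_simps)
    then have "r = 1" using assms by simp
    then show False using eq assms by simp
  qed
qed

text \<open>One implication suffices, since inverting again gives the converse. With
  \<open>l\<close> the derivative of the inversion at \<open>c\<close>, the witnesses
  \<open>a\<close>, \<open>b\<close> and \<open>R\<close> become \<open>l * a\<close>,
  \<open>l * b\<close> and \<open>flip P R\<close>.\<close>

lemma sees_over_on_right_lift_invert:
  assumes reg: "regular_projection L" and P: "P \<notin> proj ` L"
    and \<sigma>: "\<sigma> \<subseteq> regions (projected_diagram L)"
    and sees: "sees_over_on_right (projected_diagram L) \<sigma> c"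
  shows "sees_over_on_right (projected_diagram (lift_invert P ` L)) (flip P ` \<sigma>) (invert P c)"
proof -
  let ?D = "projected_diagram L" and ?L' = "lift_invert P ` L"
  let ?D' = "projected_diagram ?L'"
  obtain \<Gamma> where "link_parametrization \<Gamma> L"
    using reg unfolding regular_projection_def by blast
  then have comp: "compact L" by (rule compact_link)
  obtain R a b where R: "R \<in> unshaded ?D \<sigma>" and a: "a \<in> over_dirs ?D c" and b: "b \<in> under_dirs ?D c"
    and ev: "\<forall>\<^sub>F t in at_right 0. c + of_real t * (a + b) \<in> R" and im: "Im (cnj b * a) > 0"
    using sees unfolding sees_over_on_right_def by blast
  obtain v p q where v: "a = proj v" "p \<in> L" "q \<in> L" "proj p = c" "proj q = c" "height p > height q"
    "tangent_vector L p v"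
    using a by (auto simp: projected_diagram_def)
  obtain w q' p' where w: "b = proj w" "q' \<in> L" "p' \<in> L" "proj q' = c" "proj p' = c"
    "height q' < height p'" "tangent_vector L q' w"
    using b by (auto simp: projected_diagram_def)
  \<comment> \<open>\<open>over_dirs\<close> and \<open>under_dirs\<close> choose their points
    separately; as the fibre has only two points, the lower point \<open>q'\<close> must be
    \<open>q\<close>.\<close>
  have fibre: "{x \<in> L. proj x = c} = {p, q}"
  proof -
    have "finite {x \<in> L. proj x = c}" "card {x \<in> L. proj x = c} \<le> 2"
      using reg unfolding regular_projection_def by blast+
    moreover have "{p, q} \<subseteq> {x \<in> L. proj x = c}"
      using v by auto
    moreover have "p \<noteq> q" using v(6) by auto
    then have "card {p, q} = 2" by simp
    ultimately show ?thesis using card_seteq by metis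
  qed
  have "q' \<in> {x \<in> L. proj x = c}" "p' \<in> {x \<in> L. proj x = c}" using w by simp_all
  then have "q' = q" using v(6) w(6) unfolding fibre by auto
  have cP: "c \<noteq> P" using v(2,4) P by auto
  define l where "l = - ((inverse (c - P))\<^sup>2)"
  have l: "l \<noteq> 0" using cP by (simp add: l_def)
  define v' where "v' = frechet_derivative (lift_invert P) (at p) v"
  define w' where "w' = frechet_derivative (lift_invert P) (at q) w"
  have v': "tangent_vector ?L' (lift_invert P p) v'" "proj v' = l * a"
    using tangent_vector_lift_invert[OF P v(7)] proj_lift_invert_derivative[of p P v] cP v(1,4)
    by (simp_all add: v'_def l_def)
  have w': "tangent_vector ?L' (lift_invert P q) w'" "proj w' = l * b"
    using tangent_vector_lift_invert[OF P w(7)] proj_lift_invert_derivative[of q P w] cP w(1) v(5)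
    unfolding \<open>q' = q\<close> by (simp_all add: w'_def l_def)
  have pq: "lift_invert P p \<in> ?L'" "lift_invert P q \<in> ?L'" "proj (lift_invert P p) = invert P c"
    "proj (lift_invert P q) = invert P c" "height (lift_invert P p) > height (lift_invert P q)"
    using v by simp_all
  have over: "l * a \<in> over_dirs ?D' (invert P c)"
    unfolding projected_diagram_def link_diagram.simps v'(2)[symmetric]
    using v'(1) pq by blast
  have under: "l * b \<in> under_dirs ?D' (invert P c)"
    unfolding projected_diagram_def link_diagram.simps w'(2)[symmetric]
    using w'(1) pq by blast
  have im': "Im (cnj (l * b) * (l * a)) > 0"
    unfolding Im_cnj_mult_scale using im l by simp
  have ab: "a \<noteq> 0" "b \<noteq> 0" "a + b \<noteq> 0"
    using im sum_not_on_lines(1)[of b a 0] by auto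
  \<comment> \<open>The straight and the bent ray are compared in the inverted diagram, so it is its
    universe that must be avoided. Over the crossing its link has two points, with tangent lines
    along \<open>v'\<close> and \<open>w'\<close>.\<close>
  have d: "\<not> contingent (proj ` ?L') (invert P c) (l * a + l * b)"
  proof
    assume con: "contingent (proj ` ?L') (invert P c) (l * a + l * b)"
    obtain \<Gamma>' where \<Gamma>': "link_parametrization \<Gamma>' ?L'"
      using regular_projection_lift_invert[OF reg P] unfolding regular_projection_def by blast
    define V where "V x = (if x = lift_invert P p then v' else w')" for x
    have ne: "lift_invert P p \<noteq> lift_invert P q" using pq(5) by (metis less_irrefl)
    have only: "x = lift_invert P p \<or> x = lift_invert P q" if "x \<in> ?L'" "proj x = invert P c" for x
    proof -
      have "lift_invert P x \<in> {x \<in> L. proj x = c}"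
        using that by (auto simp: lift_invert_image_iff)
      then have "lift_invert P x = p \<or> lift_invert P x = q" unfolding fibre by simp
      then show ?thesis by (metis lift_invert_lift_invert)
    qed
    have "\<exists>x\<in>?L'. proj x = invert P c \<and> (\<exists>r. l * a + l * b = r *\<^sub>R proj (V x))"
    proof (rule contingent_proj[OF compact_lift_invert[OF comp P] _ _ con])
      fix x e assume x: "x \<in> ?L'" "proj x = invert P c" and e: "contingent ?L' x e"
      have "tangent_vector ?L' x (V x)"
        using only[OF x] v'(1) w'(1) ne by (auto simp: V_def)
      then show "\<exists>r. e = r *\<^sub>R V x"
        using contingent_tangent_line[OF \<Gamma>' _ e] by blast
    next
      fix x assume "x \<in> ?L'" "proj x = invert P c"
      then show "proj (V x) \<noteq> 0"
        using v'(2) w'(2) l ab by (auto simp: V_def)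
    next
      show "l * a + l * b \<noteq> 0"
        using l ab by (metis distrib_left mult_eq_0_iff)
    qed
    then obtain r where "l * a + l * b = r *\<^sub>R (l * a) \<or> l * a + l * b = r *\<^sub>R (l * b)"
      unfolding V_def using v'(2) w'(2) by metis
    then show False
      using sum_not_on_lines[of "l * b" "l * a" r] im' by auto
  qed
  have lim: "((\<lambda>t. of_real t * (a + b)) \<longlongrightarrow> 0) (at_right 0)"
    by (auto intro!: tendsto_eq_intros)
  \<comment> \<open>One-sided velocity of the bent ray: the complex difference quotient along
    \<open>of_real t * (a + b)\<close>, rescaled to a quotient by \<open>t\<close>.\<close>
  have k: "((\<lambda>t. (invert P (c + of_real t * (a + b)) - invert P c) /\<^sub>R t) \<longlongrightarrow> l * a + l * b) (at_right 0)"
  proof -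
    have "((\<lambda>h. (invert P (c + h) - invert P c) / h) \<longlongrightarrow> l) (at 0)"
      using invert_has_field_derivative[OF cP] unfolding DERIV_def l_def .
    moreover have "filterlim (\<lambda>t. of_real t * (a + b)) (at 0) (at_right 0)"
      unfolding filterlim_at using lim ab(3) eventually_at_right_less[of "0::real"]
      by (auto elim!: eventually_mono)
    ultimately have "((\<lambda>t. (invert P (c + of_real t * (a + b)) - invert P c) / (of_real t * (a + b)))
        \<longlongrightarrow> l) (at_right 0)"
      by (rule filterlim_compose)
    then have "((\<lambda>t. (invert P (c + of_real t * (a + b)) - invert P c) / (of_real t * (a + b)) * (a + b))
        \<longlongrightarrow> l * (a + b)) (at_right 0)"
      by (intro tendsto_intros)
    moreover have "x / (of_real t * (a + b)) * (a + b) = x /\<^sub>R t" for x and t :: real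
      using ab(3) by (simp add: scaleR_conv_of_real divide_inverse mult_ac)
    ultimately show ?thesis by (simp add: distrib_left)
  qed
  have h: "((\<lambda>t. (invert P c + of_real t * (l * a + l * b) - invert P c) /\<^sub>R t)
      \<longlongrightarrow> l * a + l * b) (at_right 0)"
  proof (rule tendsto_eventually)
    show "\<forall>\<^sub>F t in at_right 0. (invert P c + of_real t * (l * a + l * b) - invert P c) /\<^sub>R t = l * a + l * b"
      using eventually_at_right_less[of "0::real"]
      by eventually_elim (simp add: scaleR_conv_of_real)
  qed
  \<comment> \<open>Membership in \<open>flip P R\<close> is tested with \<open>invert P\<close>
    only off \<open>P\<close>, which the ray avoids for small \<open>t\<close>.\<close>
  have "((\<lambda>t. c + of_real t * (a + b)) \<longlongrightarrow> c) (at_right 0)"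
    using tendsto_add[OF tendsto_const[of c] lim] by simp
  then have "\<forall>\<^sub>F t in at_right 0. c + of_real t * (a + b) \<noteq> P"
    using cP by (rule tendsto_imp_eventually_ne)
  then have kR: "\<forall>\<^sub>F t in at_right 0. invert P (c + of_real t * (a + b)) \<in> flip P R"
    using ev by eventually_elim (simp add: mem_flip_iff)
  have R': "flip P R \<in> unshaded ?D' (flip P ` \<sigma>)"
    using R unfolding unshaded_lift_invert[OF comp P \<sigma>] by blast
  then have "flip P R \<in> components (- proj ` ?L')"
    by (simp add: unshaded_def regions_def)
  from region_of_tangent_curves[OF this k h d kR]
  have "\<forall>\<^sub>F t in at_right 0. invert P c + of_real t * (l * a + l * b) \<in> flip P R" .
  then show ?thesis
    unfolding sees_over_on_right_def using R' over under im' by blast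
qed

section \<open>Goeritz matrices of the inverted diagram\<close>

context
  fixes L P \<sigma>
  assumes reg: "regular_projection L" and P: "P \<notin> proj ` L"
    and \<sigma>: "\<sigma> \<subseteq> regions (projected_diagram L)"
begin

lemma compact_regular: "compact L"
  using reg compact_link unfolding regular_projection_def by blast

lemma flip_image_twice: "flip P ` flip P ` \<sigma> = \<sigma>"
proof -
  have "flip P (flip P R) = R" if "R \<in> \<sigma>" for R
    using flip_flip_region[OF compact_regular P] \<sigma> that by blast
  then show ?thesis by (simp add: image_image)
qed

lemma flip_image_regions: "flip P ` \<sigma> \<subseteq> regions (projected_diagram (lift_invert P ` L))"
  unfolding regions_lift_invert[OF compact_regular P] using \<sigma> by blast

text \<open>Observers are carried over in both directions: back again by inverting the inverted
  link, whose flipped shading returns to \<open>\<sigma>\<close>.\<close>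

lemma goeritz_index_lift_invert:
  "goeritz_index (projected_diagram (lift_invert P ` L)) (flip P ` \<sigma>) (invert P c)
    = goeritz_index (projected_diagram L) \<sigma> c"
  using sees_over_on_right_lift_invert[OF reg P \<sigma>, of c]
    sees_over_on_right_lift_invert[OF regular_projection_lift_invert[OF reg P]
      center_not_in_lift_invert[OF P] flip_image_regions, of "invert P c"]
  by (auto simp: goeritz_index_def flip_image_twice)

lemma goeritz_offdiag_lift_invert:
  assumes "R \<in> regions (projected_diagram L)" "S \<in> regions (projected_diagram L)"
  shows "goeritz_offdiag (projected_diagram (lift_invert P ` L)) (flip P ` \<sigma>) (flip P R) (flip P S)
    = goeritz_offdiag (projected_diagram L) \<sigma> R S"
  unfolding goeritz_offdiag_def common_crossings_lift_invert[OF compact_regular P assms]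
  by (subst sum.reindex) (auto intro: inj_on_subset[OF inj_invert] simp: goeritz_index_lift_invert)

text \<open>A diagonal entry sums over all other unshaded regions, so it is kept because
  \<open>flip P\<close> is a bijection between the unshaded regions of the two diagrams.\<close>

lemma goeritz_entry_lift_invert:
  assumes R: "R \<in> unshaded (projected_diagram L) \<sigma>" and S: "S \<in> unshaded (projected_diagram L) \<sigma>"
  shows "goeritz_entry (projected_diagram (lift_invert P ` L)) (flip P ` \<sigma>) (flip P R) (flip P S)
    = goeritz_entry (projected_diagram L) \<sigma> R S"
proof -
  let ?W = "unshaded (projected_diagram L) \<sigma>"
  note inj = inj_on_flip[OF compact_regular P]
  have sub: "?W \<subseteq> regions (projected_diagram L)" by (auto simp: unshaded_def)
  have eq: "flip P R = flip P S \<longleftrightarrow> R = S"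
    using inj_on_eq_iff[OF inj] R S sub by blast
  have "flip P ` ?W - {flip P R} = flip P ` (?W - {R})"
    using inj_on_image_set_diff[OF inj, of ?W "{R}"] R sub by auto
  moreover have "(\<Sum>T\<in>flip P ` (?W - {R}).
        goeritz_offdiag (projected_diagram (lift_invert P ` L)) (flip P ` \<sigma>) (flip P R) T)
      = (\<Sum>T\<in>?W - {R}. goeritz_offdiag (projected_diagram L) \<sigma> R T)"
    using inj_on_subset[OF inj, of "?W - {R}"] R sub
    by (subst sum.reindex) (auto intro!: sum.cong goeritz_offdiag_lift_invert)
  ultimately show ?thesis
    using R S sub unfolding goeritz_entry_def eq unshaded_lift_invert[OF compact_regular P \<sigma>]
    by (auto intro!: goeritz_offdiag_lift_invert)
qed

text \<open>Mapping \<open>flip P\<close> over an enumeration of the unshaded regions reproduces the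
  very same matrix. A second inversion will give the reverse inclusion.\<close>

lemma goeritz_matrix_lift_invert_subset:
  "goeritz_matrix (projected_diagram L) \<sigma>
    \<subseteq> goeritz_matrix (projected_diagram (lift_invert P ` L)) (flip P ` \<sigma>)"
proof
  let ?W = "unshaded (projected_diagram L) \<sigma>"
  fix M assume "M \<in> goeritz_matrix (projected_diagram L) \<sigma>"
  then obtain Rs where Rs: "distinct Rs" "set Rs = ?W"
    and M: "M = Matrix.mat (length Rs) (length Rs)
      (\<lambda>(i, j). goeritz_entry (projected_diagram L) \<sigma> (Rs ! i) (Rs ! j))"
    unfolding goeritz_matrix_def by blast
  let ?Rs = "map (flip P) Rs"
  have "?W \<subseteq> regions (projected_diagram L)" by (auto simp: unshaded_def)
  then have "distinct ?Rs"
    using Rs inj_on_subset[OF inj_on_flip[OF compact_regular P]] by (simp add: distinct_map)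
  moreover have "set ?Rs = unshaded (projected_diagram (lift_invert P ` L)) (flip P ` \<sigma>)"
    using Rs(2) unshaded_lift_invert[OF compact_regular P \<sigma>] by simp
  moreover have "M = Matrix.mat (length ?Rs) (length ?Rs)
      (\<lambda>(i, j). goeritz_entry (projected_diagram (lift_invert P ` L)) (flip P ` \<sigma>) (?Rs ! i) (?Rs ! j))"
  proof -
    have "Rs ! i \<in> ?W" if "i < length Rs" for i
      using Rs(2) nth_mem[OF that] by blast
    then show ?thesis
      unfolding M by (intro eq_matI) (simp_all add: goeritz_entry_lift_invert)
  qed
  ultimately show "M \<in> goeritz_matrix (projected_diagram (lift_invert P ` L)) (flip P ` \<sigma>)"
    unfolding goeritz_matrix_def by blast
qed

end

lemma goeritz_matrix_lift_invert:
  assumes "regular_projection L" "P \<notin> proj ` L" "\<sigma> \<subseteq> regions (projected_diagram L)"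
  shows "goeritz_matrix (projected_diagram (lift_invert P ` L)) (flip P ` \<sigma>)
    = goeritz_matrix (projected_diagram L) \<sigma>"
  using goeritz_matrix_lift_invert_subset[OF assms]
    goeritz_matrix_lift_invert_subset[OF regular_projection_lift_invert[OF assms(1,2)]
      center_not_in_lift_invert[OF assms(2)] flip_image_regions[OF assms]]
  by (simp add: flip_image_twice[OF assms])

section \<open>Moving a shaded or unshaded region to infinity\<close>

lemma edges_nonempty:
  assumes reg: "regular_projection L"
  shows "edges (projected_diagram L) \<noteq> {}"
proof -
  obtain \<Gamma> where \<Gamma>: "link_parametrization \<Gamma> L"
    using reg unfolding regular_projection_def by blast
  then obtain \<gamma> where \<gamma>: "\<gamma> \<in> \<Gamma>" "simple_path \<gamma>" "path_image \<gamma> \<subseteq> L"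
    unfolding link_parametrization_def by blast
  have "inj_on \<gamma> {0<..<1}"
  proof (rule inj_onI)
    fix x y :: real assume xy: "x \<in> {0<..<1}" "y \<in> {0<..<1}" "\<gamma> x = \<gamma> y"
    then have "x \<in> {0..1}" "y \<in> {0..1}" by auto
    then have "x = y \<or> x = 0 \<and> y = 1 \<or> x = 1 \<and> y = 0"
      using \<gamma>(2) xy(3) unfolding simple_path_def loop_free_def by blast
    then show "x = y" using xy(1,2) by auto
  qed
  then have "infinite (\<gamma> ` {0<..<1})"
    using finite_imageD infinite_Ioo[of "0::real" 1] by fastforce
  moreover have "\<gamma> ` {0<..<1} \<subseteq> L"
    using \<gamma>(3) by (auto simp: path_image_def)
  ultimately have "infinite L" using finite_subset by blast
  moreover have fib: "finite {p \<in> L. proj p = c}" for c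
    using reg unfolding regular_projection_def by blast
  \<comment> \<open>As fibres are finite, the projection of the infinite set \<open>L\<close> is
    infinite, and removing finitely many crossings cannot exhaust it.\<close>
  have "finite L" if "finite (proj ` L)"
  proof -
    have "L = (\<Union>c\<in>proj ` L. {p \<in> L. proj p = c})" by blast
    then show ?thesis
      using finite_UN[OF that, of "\<lambda>c. {p \<in> L. proj p = c}"] fib by simp
  qed
  ultimately have "infinite (proj ` L)" by blast
  moreover have "crossings (projected_diagram L) \<subseteq> {c. card {p \<in> L. proj p = c} = 2}"
  proof
    fix c assume "c \<in> crossings (projected_diagram L)"
    then obtain p q where "p \<in> L" "q \<in> L" "p \<noteq> q" "proj p = c" "proj q = c"
      by (auto simp: projected_diagram_def)
    then have "{p, q} \<subseteq> {p \<in> L. proj p = c}" "card {p, q} = 2" by auto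
    moreover have "finite {p \<in> L. proj p = c}" "card {p \<in> L. proj p = c} \<le> 2"
      using reg unfolding regular_projection_def by blast+
    ultimately have "card {p \<in> L. proj p = c} = 2"
      by (metis card_mono le_antisym)
    then show "c \<in> {c. card {p \<in> L. proj p = c} = 2}" by simp
  qed
  then have "finite (crossings (projected_diagram L))"
    using reg finite_subset unfolding regular_projection_def by blast
  ultimately have "proj ` L - crossings (projected_diagram L) \<noteq> {}"
    by (metis Diff_eq_empty_iff finite_subset)
  then show ?thesis by (simp add: edges_def)
qed


text \<open>Any point of \<open>R\<close> serves as the centre. The final equivalence remembers
  whether \<open>R\<close> is shaded, so one statement serves both equalities.\<close>

lemma move_region_to_infinity:
  assumes L1: "L1 \<in> link_type L" and D: "is_diagram D L1"
    and \<sigma>: "checkerboard_shading D \<sigma>" and R: "R \<in> regions D"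
  shows "\<exists>D' \<sigma>' R'. (\<exists>L2\<in>link_type L. is_diagram D' L2) \<and> checkerboard_shading D' \<sigma>' \<and>
    goeritz_matrix D' \<sigma>' = goeritz_matrix D \<sigma> \<and>
    R' \<in> regions D' \<and> \<not> bounded R' \<and> (R' \<in> \<sigma>' \<longleftrightarrow> R \<in> \<sigma>)"
proof -
  obtain A where A: "orthogonal_transformation A" "Determinants.det (matrix A) = 1"
    and reg: "regular_projection (A ` L1)" and DA: "D = projected_diagram (A ` L1)"
    using D unfolding is_diagram_def by blast
  define M where "M = A ` L1"
  have DM: "D = projected_diagram M" and regM: "regular_projection M"
    using DA reg by (simp_all add: M_def)
  have comp: "compact M"
    using regM compact_link unfolding regular_projection_def by blast
  have RM: "R \<in> components (- proj ` M)"
    using R by (simp add: DM regions_def)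
  then obtain P where PR: "P \<in> R"
    using in_components_nonempty by blast
  then have P: "P \<notin> proj ` M"
    using in_components_subset[OF RM] by blast
  have sub: "\<sigma> \<subseteq> regions (projected_diagram M)"
    using \<sigma> by (simp add: checkerboard_shading_def DM)
  let ?L2 = "lift_invert P ` M"
  have reg2: "regular_projection ?L2"
    using regular_projection_lift_invert[OF regM P] .
  have link2: "link ?L2"
    using reg2 unfolding regular_projection_def link_def by blast
  have "\<exists>h. piecewise_smooth_autohomeo h \<and> orientation_preserving h \<and> h ` L = L1"
    using L1 by (simp add: link_type_def)
  from link_type_lift_invert[OF link_type_rotate[OF this A, folded M_def] comp P]
  have "?L2 \<in> link_type L"
    using link2 by (simp add: link_type_def)
  \<comment> \<open>The rotation \<open>A\<close> has been absorbed into the new link, so the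
    identity serves as its rotation.\<close>
  moreover have "is_diagram (projected_diagram ?L2) ?L2"
  proof -
    have "orthogonal_transformation (id :: real^3 \<Rightarrow> real^3)"
      using orthogonal_transformation_id by (simp add: id_def)
    moreover have "Determinants.det (matrix (id :: real^3 \<Rightarrow> real^3)) = 1"
      by (simp add: matrix_id_mat_1)
    ultimately show ?thesis
      unfolding is_diagram_def using link2 reg2 by (intro conjI exI[of _ id]) simp_all
  qed
  moreover have "checkerboard_shading (projected_diagram ?L2) (flip P ` \<sigma>)"
    using flip_shading[OF comp P] \<sigma> by (simp add: DM)
  moreover have "goeritz_matrix (projected_diagram ?L2) (flip P ` \<sigma>) = goeritz_matrix D \<sigma>"
    unfolding DM by (rule goeritz_matrix_lift_invert[OF regM P sub])
  moreover have "flip P R \<in> regions (projected_diagram ?L2)"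
    using flip_region[OF comp P] R by (simp add: DM)
  moreover have "\<not> bounded (flip P R)"
    using unbounded_flip[OF compact_imp_closed[OF compact_proj[OF comp]] P RM] PR by simp
  moreover have "flip P R \<in> flip P ` \<sigma> \<longleftrightarrow> R \<in> \<sigma>"
    using inj_on_image_mem_iff[OF inj_on_flip[OF comp P] _ sub] R by (simp add: DM)
  ultimately show ?thesis by blast
qed

theorem proposition2:
  fixes L :: "(real^3) set"
  assumes "link L"
  shows "goeritz_set (link_type L) = goeritz_set_s (link_type L) \<and>
         goeritz_set_s (link_type L) = goeritz_set_u (link_type L)"
proof -
  \<comment> \<open>The shading condition speaks about edges; since there is one, it borders a
    shaded and an unshaded region, and either can be moved to infinity.\<close>
  have both: "\<exists>R\<in>\<sigma>. \<exists>R'\<in>regions D - \<sigma>. R \<in> regions D"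
    if D: "is_diagram D L1" and \<sigma>: "checkerboard_shading D \<sigma>" for D L1 \<sigma>
  proof -
    obtain M where "D = projected_diagram M" "regular_projection M"
      using D unfolding is_diagram_def by blast
    then obtain e where "e \<in> edges D"
      using edges_nonempty by blast
    then show ?thesis
      using \<sigma> unfolding checkerboard_shading_def by blast
  qed
  have "goeritz_set (link_type L) \<subseteq> goeritz_set_s (link_type L)"
  proof
    fix G assume "G \<in> goeritz_set (link_type L)"
    then obtain D \<sigma> L1 where G: "G = goeritz_matrix D \<sigma>"
      and D: "L1 \<in> link_type L" "is_diagram D L1" "checkerboard_shading D \<sigma>"
      unfolding goeritz_set_def by blast
    obtain R where "R \<in> \<sigma>" "R \<in> regions D"
      using both[OF D(2,3)] by blast
    with move_region_to_infinity[OF D this(2)] show "G \<in> goeritz_set_s (link_type L)"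
      unfolding G goeritz_set_s_def unbounded_shaded_def mem_Collect_eq by metis
  qed
  moreover have "goeritz_set (link_type L) \<subseteq> goeritz_set_u (link_type L)"
  proof
    fix G assume "G \<in> goeritz_set (link_type L)"
    then obtain D \<sigma> L1 where G: "G = goeritz_matrix D \<sigma>"
      and D: "L1 \<in> link_type L" "is_diagram D L1" "checkerboard_shading D \<sigma>"
      unfolding goeritz_set_def by blast
    obtain R where "R \<notin> \<sigma>" "R \<in> regions D"
      using both[OF D(2,3)] by blast
    with move_region_to_infinity[OF D this(2)] show "G \<in> goeritz_set_u (link_type L)"
      unfolding G goeritz_set_u_def unbounded_unshaded_def unshaded_def mem_Collect_eq
      by (metis DiffI)
  qed
  moreover have "goeritz_set_s (link_type L) \<subseteq> goeritz_set (link_type L)"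
    "goeritz_set_u (link_type L) \<subseteq> goeritz_set (link_type L)"
    unfolding goeritz_set_def goeritz_set_s_def goeritz_set_u_def by blast+
  ultimately show ?thesis by blast
qed

end
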